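(* Let $\Omega\subset\mathbb{R}^2$ be a compact convex set with nonempty interior $\Omega^\circ$, and let $n\ge 1$. For a generic $n$-element set $P=\{p_1,\dots,p_n\}\subset\Omega^\circ$ (that is, for all $(p_1,\dots,p_n)\in(\Omega^\circ)^n$ outside a subset of Lebesgue measure zero), the $\Omega$-tropical curve $C(f)$ of the $\Omega$-tropical series $f=G_P\mathbf{0}_\Omega$ has genus exactly $|P|=n$.
   Context: An $\Omega$-tropical series is a function $f:\Omega\to\mathbb{R}$ such that $f\ge 0$ on $\Omega$, $f=0$ on $\partial\Omega$, and there exist coefficients $c_{ij}\in\mathbb{R}\cup\{+\infty\}$, $(i,j)\in\mathbb{Z}^2$, such that for all $(x,y)\in\Omega^\circ$, $f(x,y)=\min\{c_{ij}+ix+jy : (i,j)\in\mathbb{Z}^2\}$. Let $V(\Omega)$ denote the set of all $\Omega$-tropical series. For $f\in V(\Omega)$, the $\Omega$-tropical curve $C(f)$ is the set of points of $\Omega^\circ$ at which $f$ is not smooth (the corner locus). For a finite set $P\subset\Omega^\circ$ and $f\in V(\Omega)$, define $G_Pf(x,y)=\min\{g(x,y) : g\in V(\Omega),\ g\ge f,\ P\subset C(g)\}$ (pointwise). $\mathbf{0}_\Omega$ denotes the identically zero function on $\Omega$ (an $\Omega$-tropical series). The genus of an $\Omega$-tropical curve $C(f)$ is the number of connected components of $\Omega^\circ\setminus C(f)$ whose closure does not intersect $\partial\Omega$. *)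

theory Defs
  imports "HOL-Analysis.Analysis" "HOL-Probability.Probability"
begin

definition trop_series :: "(real \<times> real) set \<Rightarrow> (real \<times> real \<Rightarrow> real) \<Rightarrow> bool" where
  "trop_series \<Omega> f \<longleftrightarrow>
     (\<forall>p\<in>\<Omega>. 0 \<le> f p) \<and> (\<forall>p\<in>frontier \<Omega>. f p = 0) \<and>
     (\<exists>c :: int \<times> int \<Rightarrow> ereal. c ` UNIV \<subseteq> {PInfty} \<union> range ereal \<and>
        (\<forall>x y. (x, y) \<in> interior \<Omega> \<longrightarrow>
           (\<exists>i j. ereal (f (x, y)) = c (i, j) + ereal (real_of_int i * x + real_of_int j * y) \<and>
              (\<forall>i' j'. ereal (f (x, y)) \<le> c (i', j') + ereal (real_of_int i' * x + real_of_int j' * y)))))"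

definition trop_curve :: "(real \<times> real) set \<Rightarrow> (real \<times> real \<Rightarrow> real) \<Rightarrow> (real \<times> real) set" where
  "trop_curve \<Omega> f = {p \<in> interior \<Omega>. \<not> (f differentiable (at p))}"

definition G_op :: "(real \<times> real) set \<Rightarrow> (real \<times> real) set \<Rightarrow> (real \<times> real \<Rightarrow> real) \<Rightarrow> (real \<times> real \<Rightarrow> real)" where
  "G_op \<Omega> P f = (\<lambda>p. Inf {g p | g. trop_series \<Omega> g \<and> (\<forall>q\<in>\<Omega>. f q \<le> g q) \<and> P \<subseteq> trop_curve \<Omega> g})"

definition zero_Omega :: "real \<times> real \<Rightarrow> real" where
  "zero_Omega = (\<lambda>_. 0)"

definition trop_genus :: "(real \<times> real) set \<Rightarrow> (real \<times> real \<Rightarrow> real) \<Rightarrow> nat" where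
  "trop_genus \<Omega> f = card {U \<in> components (interior \<Omega> - trop_curve \<Omega> f). closure U \<inter> frontier \<Omega> = {}}"

end

theory Submission
  imports Defs
begin

text \<open>
  A function is an \<open>\<Omega>\<close>-tropical series iff it is nonnegative, vanishes on the frontier and has an
  integral supergradient at every interior point; the curve consists of the points with at least two
  of them. Let \<open>F = G\<^sub>P 0\<close>, let \<open>c\<^sub>a\<close> be its coefficients and \<open>m\<^sub>a\<close> the supremum of \<open>- a \<bullet> x\<close>
  over \<open>\<Omega>\<close>, so \<open>c\<^sub>a \<ge> m\<^sub>a\<close>. The components of the complement of the curve are the nonempty
  linearity regions, and the closure of the region of slope \<open>a\<close> avoids the frontier iff
  \<open>c\<^sub>a > m\<^sub>a\<close> (call \<open>a\<close> floating). So the genus is the number of floating slopes.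

  Upper bound: \<open>F\<close> is the least admissible series, so no finite nonempty set \<open>S\<close> of floating
  coefficients can be lowered simultaneously; hence some point of \<open>P\<close> has exactly one supergradient
  in \<open>S\<close>. Removing that slope from \<open>S\<close> and repeating uses a new point of \<open>P\<close> each time.

  Lower bound: each point of \<open>P\<close> gives a linear equation \<open>c\<^sub>a - c\<^sub>b = (b - a) \<bullet> p\<close> with \<open>a \<noteq> b\<close>,
  where the non-floating coefficients are the constants \<open>m\<^sub>a\<close>. With fewer than \<open>n\<close> unknowns,
  eliminating them leaves a nontrivial affine relation between the points, out of a countable family.
\<close>

section \<open>Integral supergradients\<close>

definition zvec :: "int \<times> int \<Rightarrow> real \<times> real" where
  "zvec a = (of_int (fst a), of_int (snd a))"

text \<open>The integer points of the superdifferential of \<open>f\<close> at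
  \<open>x\<close>.\<close>

definition supergrads :: "(real \<times> real) set \<Rightarrow> (real \<times> real \<Rightarrow> real) \<Rightarrow> real \<times> real \<Rightarrow> (int \<times> int) set"
  where "supergrads D f x = {a. \<forall>y\<in>D. f y \<le> f x + zvec a \<bullet> (y - x)}"

text \<open>The least coefficient with which the monomial of slope \<open>a\<close> lies above \<open>f\<close>.\<close>
definition coef :: "(real \<times> real) set \<Rightarrow> (real \<times> real \<Rightarrow> real) \<Rightarrow> int \<times> int \<Rightarrow> real"
  where "coef D f a = (SUP x\<in>D. f x - zvec a \<bullet> x)"

lemma zvec_add: "zvec (a + b) = zvec a + zvec b"
  by (simp add: zvec_def)

lemma zvec_0 [simp]: "zvec 0 = 0"
  by (simp add: zvec_def zero_prod_def)

lemma zvec_sum: "zvec (sum a I) = (\<Sum>i\<in>I. zvec (a i))"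
  by (induction I rule: infinite_finite_induct) (auto simp: zvec_add)

lemma zvec_inject [simp]: "zvec a = zvec b \<longleftrightarrow> a = b"
  by (auto simp: zvec_def prod_eq_iff)

lemma finite_zvec_norm_le: "finite {a. norm (zvec a) \<le> B}"
proof -
  have "{a. norm (zvec a) \<le> B} \<subseteq> {- \<lceil>B\<rceil>..\<lceil>B\<rceil>} \<times> {- \<lceil>B\<rceil>..\<lceil>B\<rceil>}"
  proof
    fix a assume "a \<in> {a. norm (zvec a) \<le> B}"
    then have n: "norm (zvec a) \<le> B" by simp
    have "\<bar>real_of_int (fst a)\<bar> \<le> norm (zvec a)" "\<bar>real_of_int (snd a)\<bar> \<le> norm (zvec a)"
      using norm_fst_le[of "real_of_int (fst a)" "real_of_int (snd a)"]
        norm_snd_le[of "real_of_int (snd a)" "real_of_int (fst a)"] by (auto simp: zvec_def)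
    with n have "\<bar>real_of_int (fst a)\<bar> \<le> B" "\<bar>real_of_int (snd a)\<bar> \<le> B" by linarith+
    then have "\<bar>fst a\<bar> \<le> \<lceil>B\<rceil>" "\<bar>snd a\<bar> \<le> \<lceil>B\<rceil>" by linarith+
    then show "a \<in> {- \<lceil>B\<rceil>..\<lceil>B\<rceil>} \<times> {- \<lceil>B\<rceil>..\<lceil>B\<rceil>}" by (auto simp: mem_Times_iff)
  qed
  then show ?thesis by (rule finite_subset) auto
qed

text \<open>A monomial attaining the minimum at \<open>x\<close> is an affine majorant touching
  there; conversely, the least coefficients dominating \<open>f\<close> reproduce it wherever a
  supergradient exists. This removes extended real coefficients from all later arguments.\<close>

lemma trop_series_iff_supergrads:
  assumes "interior \<Omega> \<noteq> {}"
  shows "trop_series \<Omega> f \<longleftrightarrow> (\<forall>p\<in>\<Omega>. 0 \<le> f p) \<and> (\<forall>p\<in>frontier \<Omega>. f p = 0) \<and>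
    (\<forall>x\<in>interior \<Omega>. supergrads (interior \<Omega>) f x \<noteq> {})" (is "_ \<longleftrightarrow> ?N \<and> ?Z \<and> ?S")
proof (intro iffI)
  assume T: "trop_series \<Omega> f"
  then obtain c where c: "c ` UNIV \<subseteq> {PInfty} \<union> range ereal" and
    m: "\<And>x y. (x, y) \<in> interior \<Omega> \<Longrightarrow> \<exists>i j. ereal (f (x, y)) = c (i, j) + ereal (real_of_int i * x + real_of_int j * y) \<and>
              (\<forall>i' j'. ereal (f (x, y)) \<le> c (i', j') + ereal (real_of_int i' * x + real_of_int j' * y))"
    unfolding trop_series_def by blast
  have ?S
  proof
    fix z assume z: "z \<in> interior \<Omega>"
    obtain x y where xy: "z = (x, y)" by force
    obtain i j where ij: "ereal (f (x, y)) = c (i, j) + ereal (real_of_int i * x + real_of_int j * y)"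
      using m z xy by metis
    then obtain r where r: "c (i, j) = ereal r" by (cases "c (i, j)") auto
    have "f w \<le> f z + zvec (i, j) \<bullet> (w - z)" if w: "w \<in> interior \<Omega>" for w
    proof -
      obtain u v where uv: "w = (u, v)" by force
      have "ereal (f (u, v)) \<le> c (i, j) + ereal (real_of_int i * u + real_of_int j * v)"
        using m w uv by metis
      then show ?thesis using ij r by (simp add: uv xy zvec_def inner_prod_def algebra_simps)
    qed
    then show "supergrads (interior \<Omega>) f z \<noteq> {}" unfolding supergrads_def by blast
  qed
  with T show "?N \<and> ?Z \<and> ?S" by (simp add: trop_series_def)
next
  assume R: "?N \<and> ?Z \<and> ?S"
  \<comment> \<open>The supremum can be infinite for unbounded \<Omega>, hence \<open>ereal\<close>;
    the nonempty interior excludes minus infinity.\<close>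
  define c where "c a = (SUP x\<in>interior \<Omega>. ereal (f x - zvec a \<bullet> x))" for a
  have ge: "ereal (f z) \<le> c a + ereal (zvec a \<bullet> z)" if "z \<in> interior \<Omega>" for a z
  proof -
    have "ereal (f z - zvec a \<bullet> z) \<le> c a" unfolding c_def using that by (rule SUP_upper)
    then have "ereal (f z - zvec a \<bullet> z) + ereal (zvec a \<bullet> z) \<le> c a + ereal (zvec a \<bullet> z)"
      by (rule add_right_mono)
    then show ?thesis by simp
  qed
  have eq: "ereal (f z) = c a + ereal (zvec a \<bullet> z)"
    if "z \<in> interior \<Omega>" "a \<in> supergrads (interior \<Omega>) f z" for a z
  proof -
    have "c a = ereal (f z - zvec a \<bullet> z)"
      unfolding c_def
    proof (rule antisym[OF SUP_least SUP_upper[OF that(1)]])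
      fix x assume "x \<in> interior \<Omega>"
      then have "f x \<le> f z + zvec a \<bullet> (x - z)" using that by (simp add: supergrads_def)
      then show "ereal (f x - zvec a \<bullet> x) \<le> ereal (f z - zvec a \<bullet> z)"
        by (simp add: inner_diff_right)
    qed
    then show ?thesis by simp
  qed
  have "c a \<noteq> - \<infinity>" for a
    using ge[of _ a] assms by fastforce
  then have "c ` UNIV \<subseteq> {PInfty} \<union> range ereal"
    by (auto; metis ereal.exhaust rangeI infinity_ereal_def uminus_ereal.simps(2) MInfty_eq_minfinity)
  moreover have "\<exists>i j. ereal (f (x, y)) = c (i, j) + ereal (real_of_int i * x + real_of_int j * y) \<and>
              (\<forall>i' j'. ereal (f (x, y)) \<le> c (i', j') + ereal (real_of_int i' * x + real_of_int j' * y))"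
    if "(x, y) \<in> interior \<Omega>" for x y
  proof -
    have "supergrads (interior \<Omega>) f (x, y) \<noteq> {}"
      using conjunct2[OF conjunct2[OF R]] that by (rule bspec)
    then obtain i j where ij: "(i, j) \<in> supergrads (interior \<Omega>) f (x, y)"
      by (metis all_not_in_conv surj_pair)
    have ip: "real_of_int k * x + real_of_int l * y = zvec (k, l) \<bullet> (x, y)" for k l
      by (simp add: zvec_def)
    show ?thesis unfolding ip using eq[OF that ij] ge[OF that] by blast
  qed
  ultimately show "trop_series \<Omega> f" using R unfolding trop_series_def by blast
qed

text \<open>Walking a distance \<open>r\<close> from \<open>x\<close> against \<open>a\<close>
  lowers the supporting affine function by \<open>norm (zvec a) * r\<close>, yet it must stay above
  a nonnegative \<open>f\<close>. This bound leaves only finitely many competing slopes.\<close>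

lemma supergrad_norm_bound:
  assumes "cball x r \<subseteq> D" "r > 0" "\<And>y. y \<in> D \<Longrightarrow> 0 \<le> f y" "a \<in> supergrads D f x"
  shows "norm (zvec a) * r \<le> f x"
proof (cases "zvec a = 0")
  case True
  have "x \<in> D" using assms(1,2) by (metis centre_in_cball less_imp_le subsetD)
  then show ?thesis using True assms(3) by simp
next
  case False
  define y where "y = x - (r / norm (zvec a)) *\<^sub>R zvec a"
  have "y \<in> cball x r" using False assms(2) by (simp add: y_def dist_norm)
  then have "y \<in> D" using assms by blast
  then have "0 \<le> f y" "f y \<le> f x + zvec a \<bullet> (y - x)"
    using assms(3)[of y] assms(4) unfolding supergrads_def by blast+
  then have "0 \<le> f x + zvec a \<bullet> (y - x)" by linarith
  moreover have "zvec a \<bullet> (y - x) = - (norm (zvec a) * r)"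
    using False by (simp add: y_def power2_norm_eq_inner[symmetric] power2_eq_square)
  ultimately show ?thesis by simp
qed

text \<open>The affine majorant minus \<open>f\<close> has a minimum at \<open>x\<close>, so a
  derivative of \<open>f\<close> there would equal every supergradient.\<close>

lemma not_differentiable_if_two_supergrads:
  assumes "open D" "x \<in> D" "a \<in> supergrads D f x" "b \<in> supergrads D f x" "a \<noteq> b"
  shows "\<not> f differentiable (at x)"
proof
  assume "f differentiable (at x)"
  then obtain L where L: "(f has_derivative L) (at x)" by (auto simp: differentiable_def)
  have "L = (\<lambda>u. zvec c \<bullet> u)" if c: "c \<in> supergrads D f x" for c
  proof -
    have d: "((\<lambda>y. f x + zvec c \<bullet> (y - x) - f y) has_derivative (\<lambda>u. zvec c \<bullet> u - L u)) (at x)"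
      by (rule derivative_eq_intros L | simp)+
    have "(\<lambda>u. zvec c \<bullet> u - L u) = (\<lambda>v. 0)"
    proof (rule differential_zero_maxmin[OF assms(2,1) d], rule disjI2, rule ballI)
      fix y assume "y \<in> D"
      then have "f y \<le> f x + zvec c \<bullet> (y - x)" using c unfolding supergrads_def by blast
      then show "f x + zvec c \<bullet> (x - x) - f x \<le> f x + zvec c \<bullet> (y - x) - f y" by simp
    qed
    then show ?thesis by (metis eq_iff_diff_eq_0)
  qed
  then have "zvec a \<bullet> u = zvec b \<bullet> u" for u using assms by metis
  then have "zvec a = zvec b" using vector_eq_rdot by blast
  with assms show False by simp
qed

section \<open>Linearity regions of a tropical series\<close>

locale trop_on =
  fixes D :: "(real \<times> real) set" and f :: "real \<times> real \<Rightarrow> real"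
  assumes open_D: "open D" and bounded_D: "bounded D"
    and nonneg: "x \<in> D \<Longrightarrow> 0 \<le> f x"
    and supergrads_nonempty: "x \<in> D \<Longrightarrow> supergrads D f x \<noteq> {}"
begin

abbreviation "sg \<equiv> supergrads D f"

lemma bounded_above: "\<exists>B. \<forall>x\<in>D. f x \<le> B"
proof (cases "D = {}")
  case False
  then obtain x a where x: "x \<in> D" "a \<in> sg x" using supergrads_nonempty by blast
  obtain R where R: "\<And>y. y \<in> D \<Longrightarrow> norm y \<le> R" using bounded_D bounded_iff by metis
  have "f y \<le> f x + norm (zvec a) * (R + norm x)" if "y \<in> D" for y
  proof -
    have "f y \<le> f x + zvec a \<bullet> (y - x)" using x that by (simp add: supergrads_def)
    also have "zvec a \<bullet> (y - x) \<le> norm (zvec a) * norm (y - x)" by (rule norm_cauchy_schwarz)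
    also have "\<dots> \<le> norm (zvec a) * (R + norm x)"
      using R[OF that] norm_triangle_ineq4[of y x] by (intro mult_left_mono) auto
    finally show ?thesis by simp
  qed
  then show ?thesis by blast
qed auto

lemma bdd_above_coef: "bdd_above ((\<lambda>x. f x - zvec a \<bullet> x) ` D)"
proof -
  obtain B where B: "\<And>x. x \<in> D \<Longrightarrow> f x \<le> B" using bounded_above by blast
  obtain R where R: "\<And>y. y \<in> D \<Longrightarrow> norm y \<le> R" using bounded_D bounded_iff by metis
  have "f x - zvec a \<bullet> x \<le> B + norm (zvec a) * R" if "x \<in> D" for x
  proof -
    have "- (zvec a \<bullet> x) \<le> norm (zvec a) * norm x"
      using Cauchy_Schwarz_ineq2[of "zvec a" x] by linarith
    also have "\<dots> \<le> norm (zvec a) * R" using R[OF that] by (intro mult_left_mono) auto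
    finally show ?thesis using B[OF that] by simp
  qed
  then show ?thesis by (rule bdd_aboveI2)
qed

lemma le_coef: "x \<in> D \<Longrightarrow> f x \<le> coef D f a + zvec a \<bullet> x"
  using cSUP_upper[OF _ bdd_above_coef, of x a] by (simp add: coef_def)

lemma supergrads_iff_coef:
  assumes "x \<in> D" shows "a \<in> sg x \<longleftrightarrow> coef D f a + zvec a \<bullet> x = f x"
proof
  assume a: "a \<in> sg x"
  have "coef D f a \<le> f x - zvec a \<bullet> x"
    unfolding coef_def using assms a by (intro cSUP_least) (auto simp: supergrads_def inner_diff_right)
  with le_coef[OF assms, of a] show "coef D f a + zvec a \<bullet> x = f x" by simp
next
  assume "coef D f a + zvec a \<bullet> x = f x"
  then have "f y \<le> f x + zvec a \<bullet> (y - x)" if "y \<in> D" for y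
    using le_coef[OF that, of a] by (simp add: inner_diff_right)
  then show "a \<in> sg x" unfolding supergrads_def by blast
qed

text \<open>Points within \<open>r / 2\<close> of \<open>x\<close> keep a ball of radius
  \<open>r / 2\<close> inside \<open>D\<close>, and \<open>f\<close> is bounded, so the norm bound
  on slopes is uniform near \<open>x\<close>.\<close>

lemma supergrads_locally_finite:
  assumes "x \<in> D"
  shows "\<exists>e K. e > 0 \<and> ball x e \<subseteq> D \<and> finite K \<and> (\<forall>y\<in>ball x e. sg y \<subseteq> K)"
proof -
  obtain B where B: "\<And>x. x \<in> D \<Longrightarrow> f x \<le> B" using bounded_above by blast
  obtain r where r: "r > 0" "cball x r \<subseteq> D" using open_D assms open_contains_cball by metis
  have "norm (zvec a) \<le> B / (r / 2)" if y: "y \<in> ball x (r / 2)" and a: "a \<in> sg y" for y a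
  proof -
    have "cball y (r / 2) \<subseteq> cball x r"
      using y by (simp add: cball_subset_cball_iff dist_commute)
    then have "norm (zvec a) * (r / 2) \<le> f y"
      using r a nonneg by (intro supergrad_norm_bound[of y "r/2" D f a]) (blast | simp)+
    also have "y \<in> D" using \<open>cball y (r / 2) \<subseteq> cball x r\<close> r
      by (meson centre_in_cball half_gt_zero less_imp_le subsetD)
    then have "f y \<le> B" using B by blast
    finally show ?thesis using r(1) by (simp add: field_simps)
  qed
  then have "\<forall>y\<in>ball x (r / 2). sg y \<subseteq> {a. norm (zvec a) \<le> B / (r / 2)}" by blast
  moreover have "ball x (r / 2) \<subseteq> cball x r" using r(1) by (simp add: ball_subset_cball_iff)
  moreover have "r / 2 > 0" using r(1) by simp
  ultimately show ?thesis using r(2) finite_zvec_norm_le by (meson subset_trans)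
qed

text \<open>Only finitely many slopes compete near \<open>x\<close>; one that is not active at
  \<open>x\<close> is strictly larger there, and a strict inequality of affine functions persists
  nearby.\<close>

lemma supergrads_upper_semicontinuous:
  assumes "x \<in> D"
  shows "\<exists>e>0. ball x e \<subseteq> D \<and> (\<forall>y\<in>ball x e. sg y \<subseteq> sg x)"
proof -
  obtain e K where e: "e > 0" "ball x e \<subseteq> D" "finite K" "\<forall>y\<in>ball x e. sg y \<subseteq> K"
    using supergrads_locally_finite[OF assms] by blast
  obtain a where a: "a \<in> sg x" using supergrads_nonempty assms by blast
  have "\<forall>b\<in>K - sg x. eventually (\<lambda>y. coef D f a + zvec a \<bullet> y < coef D f b + zvec b \<bullet> y) (nhds x)"
  proof
    fix b assume b: "b \<in> K - sg x"
    have "coef D f a + zvec a \<bullet> x < coef D f b + zvec b \<bullet> x"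
      using a b supergrads_iff_coef[OF assms] le_coef[OF assms, of b] by (auto simp: less_le)
    then have "x \<in> {y. coef D f a + zvec a \<bullet> y < coef D f b + zvec b \<bullet> y}" by simp
    moreover have "open {y. coef D f a + zvec a \<bullet> y < coef D f b + zvec b \<bullet> y}"
      by (intro open_Collect_less continuous_intros)
    ultimately show "eventually (\<lambda>y. coef D f a + zvec a \<bullet> y < coef D f b + zvec b \<bullet> y) (nhds x)"
      by (auto simp: eventually_nhds)
  qed
  then have "eventually (\<lambda>y. \<forall>b\<in>K - sg x. coef D f a + zvec a \<bullet> y < coef D f b + zvec b \<bullet> y) (nhds x)"
    using e(3) by (intro eventually_ball_finite) auto
  then obtain d where d: "d > 0"
    "\<And>y b. dist y x < d \<Longrightarrow> b \<in> K - sg x \<Longrightarrow> coef D f a + zvec a \<bullet> y < coef D f b + zvec b \<bullet> y"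
    unfolding eventually_nhds_metric by blast
  have "sg y \<subseteq> sg x" if y: "y \<in> ball x (min d e)" for y
  proof
    fix b assume b: "b \<in> sg y"
    have yD: "y \<in> D" using y e(2) by auto
    have "coef D f b + zvec b \<bullet> y = f y" using supergrads_iff_coef yD b by blast
    then have "\<not> coef D f a + zvec a \<bullet> y < coef D f b + zvec b \<bullet> y"
      using le_coef[OF yD, of a] by simp
    moreover have "b \<in> K" using e y b by auto
    ultimately show "b \<in> sg x" using d(2)[of y b] y by (auto simp: dist_commute)
  qed
  moreover have "ball x (min d e) \<subseteq> D" using e(2) by auto
  ultimately show ?thesis using d(1) e(1) by (intro exI[of _ "min d e"] conjI ballI) auto
qed

definition "region a = {x \<in> D. sg x = {a}}"

lemma region_subset: "region a \<subseteq> D"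
  by (auto simp: region_def)

lemma region_unique: "x \<in> region a \<Longrightarrow> x \<in> region b \<Longrightarrow> a = b"
  by (simp add: region_def)

lemma region_nhd:
  assumes "x \<in> region a" shows "\<exists>e>0. ball x e \<subseteq> region a"
proof -
  obtain e where "e > 0" "ball x e \<subseteq> D" "\<forall>y\<in>ball x e. sg y \<subseteq> sg x"
    using supergrads_upper_semicontinuous region_subset assms by blast
  moreover have "sg x = {a}" using assms by (simp add: region_def)
  ultimately have "y \<in> D" "sg y \<subseteq> {a}" if "y \<in> ball x e" for y
    using that by auto
  then have "y \<in> region a" if y: "y \<in> ball x e" for y
  proof -
    have "sg y = {} \<or> sg y = {a}" using \<open>y \<in> ball x e \<Longrightarrow> sg y \<subseteq> {a}\<close> y by (simp add: subset_singleton_iff)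
    then show ?thesis using \<open>y \<in> ball x e \<Longrightarrow> y \<in> D\<close> supergrads_nonempty[of y] y by (simp add: region_def)
  qed
  then show ?thesis using \<open>e > 0\<close> by blast
qed

lemma open_region: "open (region a)"
  using region_nhd by (auto simp: open_contains_ball)

text \<open>At both endpoints the monomial \<open>a\<close> is strictly below every other one, and
  strict inequalities of affine functions pass to convex combinations.\<close>

lemma convex_region:
  assumes "convex D" shows "convex (region a)"
proof (rule convexI)
  fix x y and u v :: real
  assume x: "x \<in> region a" and y: "y \<in> region a" and uv: "0 \<le> u" "0 \<le> v" "u + v = 1"
  define z where "z = u *\<^sub>R x + v *\<^sub>R y"
  have z: "z \<in> D" unfolding z_def using assms x y uv by (auto simp: region_def convex_def)
  have "b = a" if b: "b \<in> sg z" for b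
  proof (rule ccontr)
    assume "b \<noteq> a"
    then have "b \<notin> sg x" "b \<notin> sg y" using x y by (auto simp: region_def)
    then have lt: "coef D f a + zvec a \<bullet> w < coef D f b + zvec b \<bullet> w" if "w \<in> {x, y}" for w
    proof -
      have w: "w \<in> D" "a \<in> sg w" "b \<notin> sg w"
        using that x y \<open>b \<notin> sg x\<close> \<open>b \<notin> sg y\<close> by (auto simp: region_def)
      show ?thesis using w(2,3) le_coef[OF w(1), of b]
        unfolding supergrads_iff_coef[OF w(1)] by simp
    qed
    have aff: "coef D f c + zvec c \<bullet> z = u * (coef D f c + zvec c \<bullet> x) + v * (coef D f c + zvec c \<bullet> y)" for c
    proof -
      have "coef D f c = u * coef D f c + v * coef D f c" using uv by (metis distrib_right mult_1)
      then show ?thesis by (simp add: z_def inner_add_right algebra_simps)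
    qed
    have "coef D f a + zvec a \<bullet> z < coef D f b + zvec b \<bullet> z"
    proof (cases "u = 0")
      case True then show ?thesis using lt[of y] uv by (simp add: z_def)
    next
      case False
      then have "u * (coef D f a + zvec a \<bullet> x) < u * (coef D f b + zvec b \<bullet> x)"
        using lt[of x] uv by simp
      moreover have "v * (coef D f a + zvec a \<bullet> y) \<le> v * (coef D f b + zvec b \<bullet> y)"
        using lt[of y] uv by (intro mult_left_mono) auto
      ultimately show ?thesis unfolding aff by linarith
    qed
    then show False using b supergrads_iff_coef[OF z, of b] le_coef[OF z, of a] by simp
  qed
  then show "u *\<^sub>R x + v *\<^sub>R y \<in> region a"
    using z supergrads_nonempty[OF z] unfolding region_def z_def[symmetric] by blast
qed

lemma differentiable_iff_region:
  assumes "x \<in> D" shows "f differentiable (at x) \<longleftrightarrow> (\<exists>a. x \<in> region a)"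
proof
  assume "f differentiable (at x)"
  then show "\<exists>a. x \<in> region a"
    using not_differentiable_if_two_supergrads[OF open_D assms] supergrads_nonempty[OF assms] assms
    unfolding region_def by blast
next
  assume "\<exists>a. x \<in> region a"
  then obtain a where a: "x \<in> region a" by blast
  have "((\<lambda>y. coef D f a + zvec a \<bullet> y) has_derivative (\<lambda>u. zvec a \<bullet> u)) (at x)"
    by (rule derivative_eq_intros | simp)+
  then have "(f has_derivative (\<lambda>u. zvec a \<bullet> u)) (at x)"
    by (rule has_derivative_transform_within_open[OF _ open_region a])
      (auto simp: region_def supergrads_iff_coef)
  then show "f differentiable (at x)" by (auto simp: differentiable_def)
qed

lemma two_supergrads:
  assumes "x \<in> D" "\<not> f differentiable (at x)"
  obtains a b where "a \<in> sg x" "b \<in> sg x" "a \<noteq> b"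
proof -
  obtain a where "a \<in> sg x" using supergrads_nonempty assms by blast
  moreover have "sg x \<noteq> {a}" using assms differentiable_iff_region[of x] unfolding region_def by blast
  ultimately show ?thesis using that by blast
qed

text \<open>The regions are open, connected by convexity and pairwise disjoint, and such a partition
  is the one into components.\<close>

lemma components_regions:
  assumes "convex D"
  shows "components (D - {x \<in> D. \<not> f differentiable (at x)}) = region ` {a. region a \<noteq> {}}"
proof (rule components_open_unique)
  show "pairwise disjnt (region ` {a. region a \<noteq> {}})"
    unfolding pairwise_def disjnt_def using region_unique by blast
  show "\<Union> (region ` {a. region a \<noteq> {}}) = D - {x \<in> D. \<not> f differentiable (at x)}"
  proof (intro set_eqI iffI)
    fix x assume "x \<in> \<Union> (region ` {a. region a \<noteq> {}})"
    then obtain a where "x \<in> region a" by blast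
    then show "x \<in> D - {x \<in> D. \<not> f differentiable (at x)}"
      using differentiable_iff_region region_subset by blast
  next
    fix x assume "x \<in> D - {x \<in> D. \<not> f differentiable (at x)}"
    then obtain a where "x \<in> region a" using differentiable_iff_region by blast
    then show "x \<in> \<Union> (region ` {a. region a \<noteq> {}})" by blast
  qed
qed (use assms convex_connected convex_region open_region in auto)

lemma inj_on_region: "inj_on region {a. region a \<noteq> {}}"
proof (rule inj_onI)
  fix a b assume "a \<in> {a. region a \<noteq> {}}" "region a = region b"
  then show "a = b" using region_unique by blast
qed

text \<open>A slope in \<open>sg x\<close> may have an empty region, being active only where it is
  tied. The equations at the points of \<open>P\<close> need slopes with nonempty regions, since for
  these the coefficient is either floating or equal to \<open>supp\<close>.\<close>

lemma two_adjacent_regions: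
  assumes "x \<in> D" "\<not> f differentiable (at x)"
  obtains a b where "a \<in> sg x" "b \<in> sg x" "a \<noteq> b" "region a \<noteq> {}" "region b \<noteq> {}"
proof -
  \<comment> \<open>An irrational direction separates all integer slopes; moving from \<open>x\<close> along it and against it
    selects a single slope each time.\<close>
  obtain t :: real where t: "t \<notin> \<rat>" using countable_rat uncountable_UNIV_real
    by (metis UNIV_eq_I)
  define u where "u = (1 :: real, t)"
  have inj: "a = b" if "zvec a \<bullet> u = zvec b \<bullet> u" for a b
  proof -
    have eq: "real_of_int (fst a) - real_of_int (fst b) = (real_of_int (snd b) - real_of_int (snd a)) * t"
      using that by (simp add: zvec_def u_def algebra_simps)
    have "snd a = snd b"
    proof (rule ccontr)
      assume "snd a \<noteq> snd b"
      then have "t = (real_of_int (fst a) - real_of_int (fst b)) / (real_of_int (snd b) - real_of_int (snd a))"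
        using eq by (simp add: field_simps)
      also have "\<dots> \<in> \<rat>" by auto
      finally show False using t by simp
    qed
    with eq show ?thesis by (simp add: prod_eq_iff)
  qed
  obtain e where e: "e > 0" "ball x e \<subseteq> D" "\<forall>y\<in>ball x e. sg y \<subseteq> sg x"
    using supergrads_upper_semicontinuous assms by blast
  \<comment> \<open>The slope active just beyond \<open>x\<close> in direction
    \<open>s *\<^sub>R u\<close> has the least pairing with \<open>u\<close> in \<open>sg x\<close>
    for \<open>s = 1\<close> and the greatest for \<open>s = -1\<close>.\<close>
  have key: "\<exists>a. a \<in> sg x \<and> region a \<noteq> {} \<and> (\<forall>b\<in>sg x. s * (zvec a \<bullet> u) \<le> s * (zvec b \<bullet> u))"
    if s: "\<bar>s\<bar> = 1" for s :: real
  proof -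
    define d where "d = e / (2 * norm u)"
    have "norm u > 0" by (simp add: u_def zero_prod_def)
    then have d: "d > 0" "d * norm u < e" using e by (auto simp: d_def)
    define y where "y = x + (s * d) *\<^sub>R u"
    have y: "y \<in> ball x e" using d s by (simp add: y_def dist_norm abs_mult)
    then have yD: "y \<in> D" using e by blast
    have val: "f y = f x + s * d * (zvec a \<bullet> u)" if "a \<in> sg y" for a
    proof -
      have "a \<in> sg x" using e y that by blast
      then have "coef D f a + zvec a \<bullet> x = f x" "coef D f a + zvec a \<bullet> y = f y"
        using that supergrads_iff_coef[OF yD, of a] supergrads_iff_coef[OF assms(1), of a] by auto
      moreover have "zvec a \<bullet> y = zvec a \<bullet> x + s * d * (zvec a \<bullet> u)"
        by (simp add: y_def inner_add_right)
      ultimately show ?thesis by simp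
    qed
    obtain a where a: "a \<in> sg y" using yD supergrads_nonempty by blast
    have "sg y = {a}"
    proof -
      have "c = a" if c: "c \<in> sg y" for c
      proof (rule inj)
        have "s * d * (zvec c \<bullet> u) = s * d * (zvec a \<bullet> u)" using val[OF a] val[OF c] by simp
        moreover have "s * d \<noteq> 0" using s d by auto
        ultimately show "zvec c \<bullet> u = zvec a \<bullet> u" by simp
      qed
      with a show ?thesis by blast
    qed
    then have "y \<in> region a" using yD by (simp add: region_def)
    then have "region a \<noteq> {}" by blast
    moreover have "s * (zvec a \<bullet> u) \<le> s * (zvec b \<bullet> u)" if "b \<in> sg x" for b
    proof -
      have "f y \<le> f x + s * d * (zvec b \<bullet> u)"
      proof -
        have "f y \<le> f x + zvec b \<bullet> (y - x)" using that yD unfolding supergrads_def by blast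
        then show ?thesis by (simp add: y_def)
      qed
      with val[OF a] have "d * (s * (zvec a \<bullet> u)) \<le> d * (s * (zvec b \<bullet> u))"
        by (simp add: algebra_simps)
      then show ?thesis using d by simp
    qed
    ultimately show ?thesis using a e y by blast
  qed
  obtain a where a: "a \<in> sg x" "region a \<noteq> {}" "\<And>b. b \<in> sg x \<Longrightarrow> zvec a \<bullet> u \<le> zvec b \<bullet> u"
    using key[of 1] by auto
  obtain b where b: "b \<in> sg x" "region b \<noteq> {}" "\<And>c. c \<in> sg x \<Longrightarrow> zvec c \<bullet> u \<le> zvec b \<bullet> u"
    using key[of "-1"] by auto
  have "a \<noteq> b"
  proof
    assume "a = b"
    then have "zvec c \<bullet> u = zvec a \<bullet> u" if "c \<in> sg x" for c
      using a(3) b(3) that by (metis antisym)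
    then have "sg x = {a}" using inj a by blast
    then show False using assms differentiable_iff_region[of x] unfolding region_def by blast
  qed
  then show ?thesis using a b that by blast
qed

end

section \<open>Counting, elimination and null hyperplanes\<close>

text \<open>After removal of the single common element \<open>s\<close>, the point \<open>p\<close>
  meets nothing that is left, so each removal costs at least one point of \<open>P\<close>.\<close>

lemma card_le_by_peeling:
  fixes M :: "'p \<Rightarrow> 'a set"
  assumes "finite P" "finite T"
    and "\<And>S. S \<subseteq> T \<Longrightarrow> S \<noteq> {} \<Longrightarrow> \<exists>p\<in>P. \<exists>s. M p \<inter> S = {s}"
  shows "card T \<le> card {p \<in> P. M p \<inter> T \<noteq> {}}"
  using assms(2,3)
proof (induction T rule: finite_psubset_induct)
  case (psubset T)
  show ?case
  proof (cases "T = {}")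
    case False
    then obtain p s where p: "p \<in> P" "M p \<inter> T = {s}" using psubset.prems[of T] by blast
    have "card (T - {s}) \<le> card {q \<in> P. M q \<inter> (T - {s}) \<noteq> {}}"
      using p by (intro psubset.IH psubset.prems) auto
    also have "\<dots> < card {q \<in> P. M q \<inter> T \<noteq> {}}"
    proof (rule psubset_card_mono)
      have "p \<in> {q \<in> P. M q \<inter> T \<noteq> {}}" "p \<notin> {q \<in> P. M q \<inter> (T - {s}) \<noteq> {}}"
        using p by auto
      then show "{q \<in> P. M q \<inter> (T - {s}) \<noteq> {}} \<subset> {q \<in> P. M q \<inter> T \<noteq> {}}" by blast
    qed (use assms in auto)
    finally have "card (T - {s}) < card {q \<in> P. M q \<inter> T \<noteq> {}}" .
    moreover have "s \<in> T" using p by auto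
    ultimately show ?thesis using psubset.hyps by (simp add: card_Diff_singleton)
  qed auto
qed

text \<open>Gaussian elimination, by induction on the equations \<open>S\<close>; the unknowns are
  the weights \<open>w\<close>.\<close>

lemma underdetermined_system_solution:
  fixes A :: "'k \<Rightarrow> 's \<Rightarrow> real"
  assumes "finite S" "finite K" "card S < card K"
  shows "\<exists>w. (\<exists>k\<in>K. w k \<noteq> 0) \<and> (\<forall>s\<in>S. (\<Sum>k\<in>K. w k * A k s) = 0)"
  using assms
proof (induction S arbitrary: K A rule: finite_induct)
  case empty
  then have "K \<noteq> {}" by auto
  then show ?case by (intro exI[of _ "\<lambda>_. 1"]) auto
next
  case (insert t S)
  show ?case
  proof (cases "\<forall>k\<in>K. A k t = 0")
    case True
    obtain w where "\<exists>k\<in>K. w k \<noteq> 0" "\<forall>s\<in>S. (\<Sum>k\<in>K. w k * A k s) = 0"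
      using insert.IH[of K A] insert.prems insert.hyps by auto
    then show ?thesis using True by (intro exI[of _ w]) auto
  next
    case False
    then obtain l where l: "l \<in> K" "A l t \<noteq> 0" by blast
    \<comment> \<open>Subtracting multiples of row \<open>l\<close> clears column \<open>t\<close>;
      the weight at \<open>l\<close> is then determined by the equation for
      \<open>t\<close>.\<close>
    define B where "B k s = A k s - A k t / A l t * A l s" for k s
    have "card S < card (K - {l})" using insert l by simp
    then obtain w where w: "\<exists>k\<in>K - {l}. w k \<noteq> 0" "\<forall>s\<in>S. (\<Sum>k\<in>K - {l}. w k * B k s) = 0"
      using insert.IH[of "K - {l}" B] insert.prems by auto
    define v where "v = w(l := - (\<Sum>k\<in>K - {l}. w k * A k t / A l t))"
    have sumv: "(\<Sum>k\<in>K. v k * A k s) = (\<Sum>k\<in>K - {l}. w k * B k s)" for s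
    proof -
      have "(\<Sum>k\<in>K. v k * A k s) = v l * A l s + (\<Sum>k\<in>K - {l}. v k * A k s)"
        using l insert.prems by (simp add: sum.remove)
      also have "(\<Sum>k\<in>K - {l}. v k * A k s) = (\<Sum>k\<in>K - {l}. w k * A k s)"
        by (rule sum.cong) (auto simp: v_def)
      also have "v l * A l s = - (\<Sum>k\<in>K - {l}. w k * A k t / A l t * A l s)"
        by (simp add: v_def sum_distrib_right)
      finally show ?thesis by (simp add: B_def sum_subtractf right_diff_distrib mult.assoc)
    qed
    have "(\<Sum>k\<in>K. v k * A k s) = 0" if "s \<in> insert t S" for s
      unfolding sumv using that w l by (auto simp: B_def)
    moreover have "\<exists>k\<in>K. v k \<noteq> 0" using w by (auto simp: v_def)
    ultimately show ?thesis by blast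
  qed
qed

text \<open>Integrate over coordinate \<open>i\<close> first: every slice is a hyperplane with
  normal \<open>w i\<close>, hence null.\<close>

lemma AE_PiM_lborel_not_hyperplane:
  fixes w :: "'i \<Rightarrow> 'a::euclidean_space"
  assumes "finite I" "i \<in> I" "w i \<noteq> 0"
  shows "AE p in PiM I (\<lambda>_. lborel). (\<Sum>k\<in>I. w k \<bullet> p k) \<noteq> c"
proof -
  interpret product_sigma_finite "\<lambda>_. lborel :: 'a measure" by standard
  define J where "J = I - {i}"
  have I: "I = insert i J" and J: "finite J" "i \<notin> J" using assms by (auto simp: J_def)
  let ?H = "{p \<in> space (PiM I (\<lambda>_. lborel)). (\<Sum>k\<in>I. w k \<bullet> p k) = c}"
  have meas [measurable]: "?H \<in> sets (PiM I (\<lambda>_. lborel))" by measurable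
  have line: "emeasure lborel {y. w i \<bullet> y = d} = 0" for d
  proof -
    have "{y. w i \<bullet> y = d} \<in> null_sets lebesgue"
      using negligible_hyperplane[of "w i" d] assms(3) by (simp add: negligible_iff_null_sets)
    moreover have "{y. w i \<bullet> y = d} \<in> sets lborel" by measurable
    ultimately show ?thesis by (simp add: null_sets_completion_iff null_setsD1)
  qed
  have "emeasure (PiM I (\<lambda>_. lborel)) ?H = (\<integral>\<^sup>+ p. indicator ?H p \<partial>PiM (insert i J) (\<lambda>_. lborel))"
    using meas unfolding I by (rule nn_integral_indicator[symmetric])
  also have "\<dots> = (\<integral>\<^sup>+ x. (\<integral>\<^sup>+ y. indicator ?H (x(i := y)) \<partial>lborel) \<partial>PiM J (\<lambda>_. lborel))"
    using meas unfolding I by (intro product_nn_integral_insert J) auto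
  also have "\<dots> \<le> (\<integral>\<^sup>+ x. (\<integral>\<^sup>+ y. indicator {y. w i \<bullet> y = c - (\<Sum>k\<in>J. w k \<bullet> x k)} y \<partial>lborel) \<partial>PiM J (\<lambda>_. lborel))"
  proof (intro nn_integral_mono)
    fix x y
    have "(\<Sum>k\<in>I. w k \<bullet> (x(i := y)) k) = w i \<bullet> y + (\<Sum>k\<in>J. w k \<bullet> x k)"
    proof -
      have "(\<Sum>k\<in>J. w k \<bullet> (x(i := y)) k) = (\<Sum>k\<in>J. w k \<bullet> x k)"
        using J by (intro sum.cong) auto
      then show ?thesis using J by (simp add: I)
    qed
    then show "(indicator ?H (x(i := y)) :: ennreal) \<le> indicator {y. w i \<bullet> y = c - (\<Sum>k\<in>J. w k \<bullet> x k)} y"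
      by (auto simp: indicator_def)
  qed
  also have "\<dots> = 0" by (simp add: line)
  finally have "emeasure (PiM I (\<lambda>_. lborel)) ?H = 0" by simp
  then show ?thesis using meas by (intro AE_I[where N = ?H]) auto
qed

section \<open>Support function and admissible series\<close>

text \<open>A vector of irrational direction is not proportional to an integer one, but Dirichlet
  approximation of the ratio of its coordinates brings a multiple of it arbitrarily close.\<close>

lemma integer_direction_approx:
  fixes v :: "real \<times> real"
  assumes "v \<noteq> 0" "\<delta> > 0"
  shows "\<exists>a t. a \<noteq> 0 \<and> t \<ge> 0 \<and> norm (zvec a - t *\<^sub>R v) < \<delta>"
proof -
  obtain x y where v: "v = (x, y)" by force
  show ?thesis
  proof (cases "x = 0")
    case True
    then have y: "y \<noteq> 0" using assms v by (auto simp: zero_prod_def)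
    define s :: int where "s = (if y > 0 then 1 else -1)"
    have "zvec (0, s) - (1 / \<bar>y\<bar>) *\<^sub>R v = 0"
      using y True by (auto simp: v zvec_def s_def zero_prod_def)
    moreover have "(0, s) \<noteq> 0" by (auto simp: zero_prod_def s_def)
    ultimately show ?thesis using assms
      by (intro exI[of _ "(0, s)"] exI[of _ "1 / \<bar>y\<bar>"]) auto
  next
    case False
    obtain N where N: "inverse (real (Suc N)) < \<delta>" using assms reals_Archimedean by blast
    obtain h k :: int where hk: "0 < k" "\<bar>of_int k * (y / x) - of_int h\<bar> < 1 / real (Suc N)"
      using Dirichlet_approx[of "Suc N" "y / x"] zero_less_Suc by metis
    define s :: int where "s = (if x > 0 then 1 else -1)"
    have s: "\<bar>real_of_int s\<bar> = 1" by (simp add: s_def)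
    \<comment> \<open>The scaling makes the first coordinates agree exactly, so only the Dirichlet
      error remains, in the second.\<close>
    have "zvec (s * k, s * h) - (of_int k / \<bar>x\<bar>) *\<^sub>R v = (0, of_int s * (of_int h - of_int k * (y / x)))"
      using False by (auto simp: v zvec_def s_def field_simps)
    then have "norm (zvec (s * k, s * h) - (of_int k / \<bar>x\<bar>) *\<^sub>R v) = \<bar>of_int k * (y / x) - of_int h\<bar>"
      using s by (simp add: norm_Pair abs_mult abs_minus_commute)
    also have "\<dots> < \<delta>" using hk N by (simp add: inverse_eq_divide)
    finally have "norm (zvec (s * k, s * h) - (of_int k / \<bar>x\<bar>) *\<^sub>R v) < \<delta>" .
    moreover have "(s * k, s * h) \<noteq> 0" using hk by (auto simp: zero_prod_def s_def)
    ultimately show ?thesis using hk(1)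
      by (intro exI[of _ "(s * k, s * h)"] exI[of _ "of_int k / \<bar>x\<bar>"]) auto
  qed
qed

locale trop_domain =
  fixes \<Omega> :: "(real \<times> real) set"
  assumes compact_Omega: "compact \<Omega>" and convex_Omega: "convex \<Omega>"
    and interior_nonempty: "interior \<Omega> \<noteq> {}"
begin

abbreviation "D \<equiv> interior \<Omega>"

text \<open>The support function of \<Omega> in direction \<open>- zvec a\<close>:
  \<open>supp a + zvec a \<bullet> x\<close> is the least affine function of slope \<open>a\<close>
  that is nonnegative on \<Omega>.\<close>

abbreviation "supp \<equiv> coef D (\<lambda>_. 0)"

lemma D_subset: "x \<in> D \<Longrightarrow> x \<in> \<Omega>"
  using interior_subset by blast

lemma frontier_Omega: "frontier \<Omega> = \<Omega> - D"
  using compact_Omega by (simp add: frontier_def compact_imp_closed)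

lemma Omega_subset_closure: "\<Omega> \<subseteq> closure D"
  using convex_closure_interior[OF convex_Omega interior_nonempty] closure_subset by auto

lemma trop_on_if_trop_series:
  assumes "trop_series \<Omega> f" shows "trop_on D f"
proof
  show "bounded D" using compact_Omega bounded_interior compact_imp_bounded by blast
  show "0 \<le> f x" if "x \<in> D" for x
    using assms that interior_subset by (auto simp: trop_series_def)
  show "supergrads D f x \<noteq> {}" if "x \<in> D" for x
    using assms that trop_series_iff_supergrads[OF interior_nonempty] by blast
qed auto

lemma trop_on_zero: "trop_on D (\<lambda>_. 0)"
proof
  show "bounded D" using compact_Omega bounded_interior compact_imp_bounded by blast
  have "0 \<in> supergrads D (\<lambda>_. 0) x" for x by (simp add: supergrads_def)
  then show "supergrads D (\<lambda>_. 0) x \<noteq> {}" for x by blast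
qed auto

lemma affine_nonneg_on_Omega:
  assumes "\<And>x. x \<in> D \<Longrightarrow> 0 \<le> c + v \<bullet> x" "z \<in> \<Omega>"
  shows "0 \<le> c + v \<bullet> z"
proof -
  have "closed {x. 0 \<le> c + v \<bullet> x}" by (intro closed_Collect_le continuous_intros)
  moreover have "D \<subseteq> {x. 0 \<le> c + v \<bullet> x}" using assms(1) by blast
  ultimately have "closure D \<subseteq> {x. 0 \<le> c + v \<bullet> x}" by (simp add: closure_minimal)
  then show ?thesis using assms(2) Omega_subset_closure by blast
qed

lemma supp_nonneg: "z \<in> \<Omega> \<Longrightarrow> 0 \<le> supp a + zvec a \<bullet> z"
  using trop_on.le_coef[OF trop_on_zero] by (rule affine_nonneg_on_Omega)

lemma supp_le:
  assumes "\<And>x. x \<in> D \<Longrightarrow> zvec a \<bullet> z \<le> zvec a \<bullet> x + \<delta>"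
  shows "supp a + zvec a \<bullet> z \<le> \<delta>"
proof -
  have "supp a \<le> \<delta> - zvec a \<bullet> z"
    unfolding coef_def using interior_nonempty
  proof (rule cSUP_least)
    fix x assume "x \<in> D"
    then show "0 - zvec a \<bullet> x \<le> \<delta> - zvec a \<bullet> z" using assms[of x] by linarith
  qed
  then show ?thesis by simp
qed

lemma supp_norm_bound:
  assumes "cball x r \<subseteq> D" "r > 0"
  shows "norm (zvec a) * r \<le> supp a + zvec a \<bullet> x"
proof (rule supergrad_norm_bound[OF assms])
  show "0 \<le> supp a + zvec a \<bullet> y" if "y \<in> D" for y
    using supp_nonneg[OF D_subset[OF that]] .
  show "a \<in> supergrads D (\<lambda>x. supp a + zvec a \<bullet> x) x"
    by (simp add: supergrads_def inner_diff_right)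
qed

lemma supp_le_coef:
  assumes "trop_on D f" shows "supp a \<le> coef D f a"
proof -
  interpret trop_on D f by fact
  show ?thesis
    unfolding coef_def using interior_nonempty
  proof (rule cSUP_mono)
    show "bdd_above ((\<lambda>x. f x - zvec a \<bullet> x) ` D)" by (rule bdd_above_coef)
    show "\<exists>m\<in>D. 0 - zvec a \<bullet> x \<le> f m - zvec a \<bullet> m" if "x \<in> D" for x
      using that nonneg[OF that] by (intro bexI[of _ x]) auto
  qed
qed

text \<open>Minimise the monomial over the compact set. A minimum at an interior point forces
  \<open>a = 0\<close>, and then every frontier point serves.\<close>

lemma supp_attained: "\<exists>z\<in>frontier \<Omega>. supp a + zvec a \<bullet> z = 0"
proof -
  have "\<Omega> \<noteq> {}" using interior_nonempty interior_subset by blast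
  moreover have "continuous_on \<Omega> (\<lambda>x. zvec a \<bullet> x)" by (intro continuous_intros)
  ultimately obtain z where z: "z \<in> \<Omega>" "\<And>x. x \<in> \<Omega> \<Longrightarrow> zvec a \<bullet> z \<le> zvec a \<bullet> x"
    using continuous_attains_inf[OF compact_Omega] by blast
  have eq: "supp a + zvec a \<bullet> z = 0"
  proof (rule antisym[OF supp_le supp_nonneg[OF z(1)]])
    show "zvec a \<bullet> z \<le> zvec a \<bullet> x + 0" if "x \<in> D" for x
      using z(2)[OF D_subset[OF that]] by simp
  qed
  show ?thesis
  proof (cases "z \<in> D")
    case False
    then show ?thesis using eq z by (auto simp: frontier_Omega)
  next
    case True
    obtain r where r: "r > 0" "cball z r \<subseteq> D" using True open_interior open_contains_cball by metis
    have "norm (zvec a) * r \<le> 0" using supp_norm_bound[OF r(2,1), of a] eq by simp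
    then have "norm (zvec a) = 0" using r(1)
      by (metis mult_pos_pos norm_ge_zero not_le order_le_less)
    then have "zvec a = 0" by simp
    moreover have "frontier \<Omega> \<noteq> {}"
      using \<open>\<Omega> \<noteq> {}\<close> compact_imp_bounded[OF compact_Omega] frontier_eq_empty[of \<Omega>] not_bounded_UNIV by auto
    ultimately show ?thesis using eq by auto
  qed
qed

text \<open>The normal of a supporting line at \<open>z\<close> may be irrational; a nearby integer
  direction yields a small value instead of 0.\<close>

lemma supp_small_at_frontier:
  assumes "z \<in> frontier \<Omega>" "\<delta> > 0"
  shows "\<exists>a. a \<noteq> 0 \<and> supp a + zvec a \<bullet> z < \<delta>"
proof -
  have z: "z \<in> \<Omega>" "z \<notin> rel_interior \<Omega>"
    using assms frontier_Omega interior_nonempty by (auto simp: rel_interior_nonempty_interior)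
  obtain v where v: "v \<noteq> 0" "\<And>y. y \<in> \<Omega> \<Longrightarrow> v \<bullet> z \<le> v \<bullet> y"
    using supporting_hyperplane_rel_boundary[OF convex_Omega z] by metis
  obtain R where R: "R > 0" "\<And>y. y \<in> \<Omega> \<Longrightarrow> norm y \<le> R"
    using compact_Omega compact_imp_bounded bounded_pos by metis
  \<comment> \<open>Points of \<Omega> are at most \<open>2 * R\<close> apart, so this error in the
    normal contributes at most \<open>\<delta> / 2\<close>.\<close>
  obtain a t where a: "a \<noteq> 0" "t \<ge> 0" "norm (zvec a - t *\<^sub>R v) < \<delta> / (4 * R)"
    using integer_direction_approx[OF v(1), of "\<delta> / (4 * R)"] assms R by auto
  have "supp a + zvec a \<bullet> z \<le> \<delta> / 2"
  proof (rule supp_le)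
    fix x assume "x \<in> D"
    then have x: "x \<in> \<Omega>" using interior_subset by blast
    have "zvec a \<bullet> (z - x) = t * (v \<bullet> (z - x)) + (zvec a - t *\<^sub>R v) \<bullet> (z - x)"
      by (simp add: inner_diff_left)
    moreover have "t * (v \<bullet> (z - x)) \<le> 0"
      using a(2) v(2)[OF x] by (simp add: inner_diff_right mult_nonneg_nonpos)
    moreover have "(zvec a - t *\<^sub>R v) \<bullet> (z - x) \<le> norm (zvec a - t *\<^sub>R v) * norm (z - x)"
      by (rule norm_cauchy_schwarz)
    moreover have "norm (zvec a - t *\<^sub>R v) * norm (z - x) \<le> \<delta> / (4 * R) * (2 * R)"
      using a(3) R(2)[OF x] R(2)[OF z(1)] norm_triangle_ineq4[of z x] R(1) assms(2)
      by (intro mult_mono) auto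
    moreover have "\<delta> / (4 * R) * (2 * R) = \<delta> / 2" using R(1) by simp
    ultimately show "zvec a \<bullet> z \<le> zvec a \<bullet> x + \<delta> / 2" by (simp add: inner_diff_right)
  qed
  then show ?thesis using a(1) assms(2) by (intro exI[of _ a]) auto
qed

section \<open>Integer distance to the frontier and an explicit admissible series\<close>

text \<open>The distance to the frontier measured by integer covectors. Truncating it at its value at \<open>p\<close>
  creates a tie between the zero slope and a nonzero one at \<open>p\<close>.\<close>
definition ldist :: "real \<times> real \<Rightarrow> real"
  where "ldist x = (INF a\<in>-{0}. supp a + zvec a \<bullet> x)"

text \<open>The values grow at least like \<open>norm (zvec a) * r\<close>, so slopes of large norm
  lose against \<open>(1, 0)\<close> and a minimum over a finite set remains.\<close>

lemma ldist_attained: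
  assumes "x \<in> D"
  obtains a where "a \<noteq> 0" "ldist x = supp a + zvec a \<bullet> x"
proof -
  let ?v = "\<lambda>a. supp a + zvec a \<bullet> x"
  obtain r where r: "r > 0" "cball x r \<subseteq> D" using assms open_interior open_contains_cball by metis
  let ?K = "{a. norm (zvec a) \<le> ?v (1, 0) / r} - {0}"
  have out: "?v (1, 0) < ?v a" if "a \<notin> ?K" "a \<noteq> 0" for a
  proof -
    have "?v (1, 0) / r < norm (zvec a)" using that by auto
    then have "?v (1, 0) < norm (zvec a) * r" using r(1) by (simp add: divide_less_eq)
    also have "\<dots> \<le> ?v a" by (rule supp_norm_bound[OF r(2,1)])
    finally show ?thesis .
  qed
  have "(1, 0) \<noteq> (0 :: int \<times> int)" by (simp add: zero_prod_def)
  then have K: "(1, 0) \<in> ?K" using out[of "(1, 0)"] by blast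
  have fin: "finite ?K" using finite_zvec_norm_le by blast
  have "?K \<noteq> {}" using K by blast
  note K_min = arg_min_if_finite(1)[OF fin this, of ?v] arg_min_least[OF fin this, of _ ?v]
  obtain a where a: "a \<in> ?K" "\<And>b. b \<in> ?K \<Longrightarrow> ?v a \<le> ?v b"
    by (rule that[OF K_min])
  have "ldist x = ?v a"
    unfolding ldist_def
  proof (rule cInf_eq_minimum)
    show "?v a \<in> ?v ` (-{0})" using a(1) by blast
    fix y assume "y \<in> ?v ` (-{0})"
    then obtain b where b: "b \<noteq> 0" "y = ?v b" by blast
    show "?v a \<le> y"
    proof (cases "b \<in> ?K")
      case False
      then show ?thesis using out[of b] b a(2)[OF K] by linarith
    qed (use a b in blast)
  qed
  then show ?thesis using a(1) that by blast
qed

lemma ldist_le: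
  assumes "x \<in> D" "a \<noteq> 0" shows "ldist x \<le> supp a + zvec a \<bullet> x"
  unfolding ldist_def
proof (rule cINF_lower)
  show "bdd_below ((\<lambda>a. supp a + zvec a \<bullet> x) ` (-{0}))"
    using supp_nonneg[OF D_subset[OF assms(1)]] by (rule bdd_belowI2)
qed (use assms in blast)

lemma ldist_nonneg: "x \<in> D \<Longrightarrow> 0 \<le> ldist x"
  using supp_nonneg[OF D_subset] ldist_attained by metis

text \<open>A sum, not a minimum, of truncated distances: supergradients add up, so a tie in one
  summand is not hidden by the others.\<close>

definition barrier :: "(real \<times> real) set \<Rightarrow> real \<times> real \<Rightarrow> real"
  where "barrier P x = (if x \<in> D then \<Sum>p\<in>P. min (ldist p) (ldist x) else 0)"

lemma supergrad_truncated_ldist: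
  assumes "x \<in> D"
  shows "\<exists>a. \<forall>y\<in>D. min t (ldist y) \<le> min t (ldist x) + zvec a \<bullet> (y - x)"
proof (cases "t \<le> ldist x")
  case True
  then show ?thesis by (intro exI[of _ 0]) auto
next
  case False
  obtain a where a: "a \<noteq> 0" "ldist x = supp a + zvec a \<bullet> x" using ldist_attained[OF assms] .
  have "min t (ldist y) \<le> min t (ldist x) + zvec a \<bullet> (y - x)" if "y \<in> D" for y
    using ldist_le[OF that a(1)] a(2) False by (simp add: inner_diff_right)
  then show ?thesis by blast
qed

lemma barrier_admissible:
  assumes "finite P" "P \<subseteq> D"
  shows "trop_series \<Omega> (barrier P)" "P \<subseteq> trop_curve \<Omega> (barrier P)"
proof -
  define a where "a x p = (SOME a. \<forall>y\<in>D. min (ldist p) (ldist y) \<le> min (ldist p) (ldist x) + zvec a \<bullet> (y - x))" for x p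
  have a: "min (ldist p) (ldist y) \<le> min (ldist p) (ldist x) + zvec (a x p) \<bullet> (y - x)"
    if "x \<in> D" "y \<in> D" for x p y
    using someI_ex[OF supergrad_truncated_ldist[OF that(1), of "ldist p"]] that(2)
    unfolding a_def by (rule bspec)
  have sg: "sum c P \<in> supergrads D (barrier P) x"
    if "x \<in> D" "\<And>p y. p \<in> P \<Longrightarrow> y \<in> D \<Longrightarrow>
      min (ldist p) (ldist y) \<le> min (ldist p) (ldist x) + zvec (c p) \<bullet> (y - x)" for x c
  proof -
    note c = that(2)
    have "barrier P y \<le> barrier P x + zvec (sum c P) \<bullet> (y - x)" if y: "y \<in> D" for y
    proof -
      have "(\<Sum>p\<in>P. min (ldist p) (ldist y)) \<le> (\<Sum>p\<in>P. min (ldist p) (ldist x) + zvec (c p) \<bullet> (y - x))"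
        by (rule sum_mono) (rule c[OF _ y])
      then show ?thesis using y \<open>x \<in> D\<close>
        by (simp add: barrier_def sum.distrib zvec_sum inner_sum_left)
    qed
    then show ?thesis unfolding supergrads_def by blast
  qed
  have nn: "0 \<le> barrier P x" for x
  proof -
    have "0 \<le> min (ldist p) (ldist x)" if "p \<in> P" "x \<in> D" for p
      using ldist_nonneg[of p] ldist_nonneg[of x] assms(2) that by auto
    then show ?thesis unfolding barrier_def by (simp add: sum_nonneg)
  qed
  have "supergrads D (barrier P) x \<noteq> {}" if "x \<in> D" for x
    using sg[OF that a[OF that]] by (rule ex_in_conv[THEN iffD1, OF exI])
  then show "trop_series \<Omega> (barrier P)"
    unfolding trop_series_iff_supergrads[OF interior_nonempty] using nn
    by (auto simp: frontier_Omega barrier_def)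
  show "P \<subseteq> trop_curve \<Omega> (barrier P)"
  proof
    fix q assume q: "q \<in> P"
    then have qD: "q \<in> D" using assms by blast
    obtain b where b: "b \<noteq> 0" "ldist q = supp b + zvec b \<bullet> q" using ldist_attained[OF qD] .
    \<comment> \<open>In the summand of \<open>q\<close> both the zero slope and \<open>b\<close>
      are allowed; the choices in the other summands stay fixed.\<close>
    have two: "sum ((a q)(q := c)) P \<in> supergrads D (barrier P) q" if "c \<in> {0, b}" for c
    proof (rule sg[OF qD])
      fix p y assume p: "p \<in> P" and y: "y \<in> D"
      show "min (ldist p) (ldist y) \<le> min (ldist p) (ldist q) + zvec (((a q)(q := c)) p) \<bullet> (y - q)"
      proof (cases "p = q")
        case True
        have "ldist y \<le> ldist q + zvec b \<bullet> (y - q)"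
          using ldist_le[OF y b(1)] b(2) by (simp add: inner_diff_right)
        then show ?thesis using True that by auto
      next
        case False
        then show ?thesis using a[OF qD y] by simp
      qed
    qed
    have upd: "sum ((a q)(q := c)) P = c + sum (a q) (P - {q})" for c
    proof -
      have "sum ((a q)(q := c)) (P - {q}) = sum (a q) (P - {q})" by (rule sum.cong) auto
      then show ?thesis using assms(1) q by (simp add: sum.remove)
    qed
    have "sum ((a q)(q := 0)) P \<noteq> sum ((a q)(q := b)) P" unfolding upd using b(1) by simp
    then have "\<not> barrier P differentiable (at q)"
      using not_differentiable_if_two_supergrads[OF open_interior qD two[of 0] two[of b]] by blast
    then show "q \<in> trop_curve \<Omega> (barrier P)" using qD by (simp add: trop_curve_def)
  qed
qed

text \<open>Together with \<open>supp_small_at_frontier\<close> this forces every series below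
  \<open>barrier P\<close> to tend to 0 at the frontier.\<close>

lemma barrier_le:
  assumes "x \<in> D" "a \<noteq> 0"
  shows "barrier P x \<le> card P * (supp a + zvec a \<bullet> x)"
proof -
  have "(\<Sum>p\<in>P. min (ldist p) (ldist x)) \<le> (\<Sum>p\<in>P. supp a + zvec a \<bullet> x)"
    using ldist_le[OF assms] by (intro sum_mono) auto
  then show ?thesis using assms by (simp add: barrier_def)
qed

end

section \<open>The least admissible series\<close>

locale trop_problem = trop_domain +
  fixes P :: "(real \<times> real) set"
  assumes finite_P: "finite P" and P_subset: "P \<subseteq> D"
begin

definition admissible :: "(real \<times> real \<Rightarrow> real) \<Rightarrow> bool"
  where "admissible g \<longleftrightarrow> trop_series \<Omega> g \<and> P \<subseteq> trop_curve \<Omega> g"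

abbreviation "F \<equiv> G_op \<Omega> P zero_Omega"

lemma admissible_nonneg: "admissible g \<Longrightarrow> x \<in> \<Omega> \<Longrightarrow> 0 \<le> g x"
  by (simp add: admissible_def trop_series_def)

lemma trop_on_admissible: "admissible g \<Longrightarrow> trop_on D g"
  by (simp add: admissible_def trop_on_if_trop_series)

lemma admissible_barrier: "admissible (barrier P)"
  by (simp add: admissible_def barrier_admissible finite_P P_subset)

lemma F_eq: "F x = (INF g\<in>Collect admissible. g x)"
proof -
  have "trop_series \<Omega> g \<and> (\<forall>q\<in>\<Omega>. zero_Omega q \<le> g q) \<and> P \<subseteq> trop_curve \<Omega> g \<longleftrightarrow> admissible g" for g
    using admissible_nonneg[of g] unfolding admissible_def zero_Omega_def by blast
  then have "F x = Inf {g x |g. admissible g}" by (simp only: G_op_def)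
  also have "{g x |g. admissible g} = (\<lambda>g. g x) ` Collect admissible" by blast
  finally show ?thesis .
qed

lemma F_le: "admissible g \<Longrightarrow> x \<in> \<Omega> \<Longrightarrow> F x \<le> g x"
  unfolding F_eq using admissible_nonneg
  by (intro cINF_lower bdd_belowI2[of _ 0]) blast+

lemma F_nonneg: "x \<in> \<Omega> \<Longrightarrow> 0 \<le> F x"
  unfolding F_eq using admissible_nonneg admissible_barrier
  by (intro cINF_greatest) blast+

lemma F_close:
  assumes "e > 0" obtains g where "admissible g" "g x < F x + e"
proof -
  have ne: "(\<lambda>g. g x) ` Collect admissible \<noteq> {}" using admissible_barrier by blast
  have "\<exists>y\<in>(\<lambda>g. g x) ` Collect admissible. y < F x + e"
    using cInf_lessD[OF ne, of "F x + e"] assms unfolding F_eq by auto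
  then show ?thesis using that by blast
qed

lemma F_frontier: "x \<in> frontier \<Omega> \<Longrightarrow> F x = 0"
proof -
  assume x: "x \<in> frontier \<Omega>"
  then have "x \<in> \<Omega>" "x \<notin> D" by (auto simp: frontier_Omega)
  then have "F x \<le> 0" using F_le[OF admissible_barrier, of x] by (simp add: barrier_def)
  with F_nonneg[OF \<open>x \<in> \<Omega>\<close>] show ?thesis by simp
qed

text \<open>Only finitely many slopes can occur. Each one that fails for \<open>F\<close> does so at
  a witness point by a positive gap, and since \<open>g\<close> is above \<open>F\<close> at the
  witness, the slope fails for \<open>g\<close> too once \<open>g x\<close> is within the gap of
  \<open>F x\<close>.\<close>

lemma supergrads_subset_if_close:
  assumes x: "x \<in> D"
  shows "\<exists>\<delta>>0. \<forall>g. admissible g \<longrightarrow> g x < F x + \<delta> \<longrightarrow> supergrads D g x \<subseteq> supergrads D F x"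
proof -
  obtain r where r: "r > 0" "cball x r \<subseteq> D" using x open_interior open_contains_cball by metis
  define K where "K = {a. norm (zvec a) \<le> (F x + 1) / r} - supergrads D F x"
  have fin: "finite K" unfolding K_def using finite_zvec_norm_le by blast
  have "\<exists>y. y \<in> D \<and> F x + zvec a \<bullet> (y - x) < F y" if "a \<in> K" for a
  proof -
    have "a \<notin> supergrads D F x" using that unfolding K_def by blast
    then show ?thesis by (simp only: supergrads_def mem_Collect_eq Ball_def not_all not_imp not_le)
  qed
  then have "\<forall>a\<in>K. \<exists>y. y \<in> D \<and> F x + zvec a \<bullet> (y - x) < F y" by blast
  from bchoice[OF this] obtain y where y: "\<forall>a\<in>K. y a \<in> D \<and> F x + zvec a \<bullet> (y a - x) < F (y a)" ..
  define gap where "gap a = F (y a) - (F x + zvec a \<bullet> (y a - x))" for a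
  \<comment> \<open>The cap 1 ensures \<open>g x \<le> F x + 1\<close>, the bound built into
    \<open>K\<close>.\<close>
  define \<delta> where "\<delta> = Min (insert 1 (gap ` K))"
  have \<delta>: "\<delta> > 0" "\<delta> \<le> 1" "\<And>a. a \<in> K \<Longrightarrow> \<delta> \<le> gap a"
  proof -
    show "\<delta> > 0" unfolding \<delta>_def using fin y by (simp add: gap_def)
  qed (use fin in \<open>simp_all add: \<delta>_def\<close>)
  have "supergrads D g x \<subseteq> supergrads D F x" if g: "admissible g" "g x < F x + \<delta>" for g
  proof
    fix a assume a: "a \<in> supergrads D g x"
    have "norm (zvec a) * r \<le> g x"
      using supergrad_norm_bound[OF r(2,1) _ a] admissible_nonneg[OF g(1)] D_subset by blast
    also have "\<dots> \<le> F x + 1" using g \<delta> by linarith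
    finally have n: "norm (zvec a) \<le> (F x + 1) / r" using r(1) by (simp add: le_divide_eq)
    show "a \<in> supergrads D F x"
    proof (rule ccontr)
      assume "a \<notin> supergrads D F x"
      then have aK: "a \<in> K" using n by (simp add: K_def)
      then have yD: "y a \<in> D" using y by blast
      have "F (y a) \<le> g (y a)" using F_le[OF g(1) D_subset[OF yD]] .
      also have "\<dots> \<le> g x + zvec a \<bullet> (y a - x)" using a yD unfolding supergrads_def by blast
      finally show False using \<delta>(3)[OF aK] g(2) by (simp add: gap_def)
    qed
  qed
  then show ?thesis using \<delta>(1) by blast
qed

lemma trop_series_F: "trop_series \<Omega> F"
proof -
  have "supergrads D F x \<noteq> {}" if x: "x \<in> D" for x
  proof -
    obtain \<delta> where \<delta>: "\<delta> > 0" "\<And>g. admissible g \<Longrightarrow> g x < F x + \<delta> \<Longrightarrow> supergrads D g x \<subseteq> supergrads D F x"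
      using supergrads_subset_if_close[OF x] by blast
    obtain g where g: "admissible g" "g x < F x + \<delta>" using F_close[OF \<delta>(1)] .
    show ?thesis using \<delta>(2)[OF g] trop_on.supergrads_nonempty[OF trop_on_admissible[OF g(1)] x] by blast
  qed
  then show ?thesis
    unfolding trop_series_iff_supergrads[OF interior_nonempty] using F_nonneg F_frontier by blast
qed

sublocale F: trop_on D F
  by (rule trop_on_if_trop_series[OF trop_series_F])

text \<open>Two supergradients at \<open>p\<close> of a nearly optimal series are also
  supergradients of \<open>F\<close>, so the tie at \<open>p\<close> survives the infimum.\<close>

lemma admissible_F: "admissible F"
  unfolding admissible_def
proof (intro conjI trop_series_F subsetI)
  fix p assume p: "p \<in> P"
  then have pD: "p \<in> D" using P_subset by blast
  obtain \<delta> where \<delta>: "\<delta> > 0" "\<And>g. admissible g \<Longrightarrow> g p < F p + \<delta> \<Longrightarrow> supergrads D g p \<subseteq> supergrads D F p"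
    using supergrads_subset_if_close[OF pD] by blast
  obtain g where g: "admissible g" "g p < F p + \<delta>" using F_close[OF \<delta>(1)] .
  interpret g: trop_on D g using g(1) by (rule trop_on_admissible)
  have "\<not> g differentiable (at p)" using g(1) p by (auto simp: admissible_def trop_curve_def)
  then obtain a b where ab: "a \<in> g.sg p" "b \<in> g.sg p" "a \<noteq> b" using g.two_supergrads[OF pD] by blast
  then have "a \<in> F.sg p" "b \<in> F.sg p" using \<delta>(2)[OF g] by blast+
  then show "p \<in> trop_curve \<Omega> F"
    using not_differentiable_if_two_supergrads[OF open_interior pD _ _ ab(3)] pD
    by (simp add: trop_curve_def)
qed

lemma F_not_differentiable:
  assumes "p \<in> P" shows "\<not> F differentiable (at p)"
  using admissible_F assms by (auto simp: admissible_def trop_curve_def)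

section \<open>Floating slopes and the upper bound\<close>

text \<open>The slopes whose coefficient exceeds the lower bound forced by nonnegativity; their regions are
  exactly those that stay away from the frontier.\<close>
definition floating :: "(int \<times> int) set"
  where "floating = {a. supp a < coef D F a \<and> F.region a \<noteq> {}}"

text \<open>Otherwise all coefficients in \<open>S\<close> could be lowered simultaneously by a small amount without
  smoothing \<open>F\<close> at a point of \<open>P\<close>.\<close>
lemma floating_peel:
  assumes S: "S \<subseteq> floating" "finite S" "S \<noteq> {}"
  shows "\<exists>p\<in>P. \<exists>s. F.sg p \<inter> S = {s}"
proof (rule ccontr)
  assume none: "\<not> ?thesis"
  let ?l = "\<lambda>a x. coef D F a + zvec a \<bullet> x"
  \<comment> \<open>Two kinds of slack limit the lowering: the room above \<open>supp\<close>, which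
    keeps the series nonnegative, and the room at a point of \<open>P\<close> before an inactive
    monomial reaches \<open>F\<close>.\<close>
  define W where "W = (\<lambda>a. coef D F a - supp a) ` S \<union>
    (\<Union>p\<in>P. (\<lambda>a. ?l a p - F p) ` (S - F.sg p))"
  have finW: "finite W" unfolding W_def using S(2) finite_P by simp
  have Wpos: "w > 0" if w: "w \<in> W" for w
  proof -
    consider a where "a \<in> S" "w = coef D F a - supp a"
      | a p where "a \<in> S" "p \<in> P" "a \<notin> F.sg p" "w = ?l a p - F p"
      using w unfolding W_def by blast
    then show ?thesis
    proof cases
      case 1
      then show ?thesis using S(1) by (auto simp: floating_def)
    next
      case 2
      then have "p \<in> D" using P_subset by blast
      then show ?thesis using 2 F.supergrads_iff_coef[of p a] F.le_coef[of p a] by simp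
    qed
  qed
  define \<epsilon> where "\<epsilon> = Min W"
  have Wne: "W \<noteq> {}" using S(3) by (simp add: W_def)
  have \<epsilon>: "\<epsilon> > 0" using Wpos Min_in[OF finW Wne] by (simp add: \<epsilon>_def)
  have \<epsilon>1: "supp a + \<epsilon> \<le> coef D F a" if "a \<in> S" for a
  proof -
    have "coef D F a - supp a \<in> W" using that by (simp add: W_def)
    then have "\<epsilon> \<le> coef D F a - supp a" unfolding \<epsilon>_def by (rule Min_le[OF finW])
    then show ?thesis by simp
  qed
  have \<epsilon>2: "F p + \<epsilon> \<le> ?l a p" if "a \<in> S" "p \<in> P" "a \<notin> F.sg p" for a p
  proof -
    have "?l a p - F p \<in> W" unfolding W_def using that by blast
    then have "\<epsilon> \<le> ?l a p - F p" unfolding \<epsilon>_def by (rule Min_le[OF finW])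
    then show ?thesis by simp
  qed
  define F' where "F' x = (if x \<in> D then Min (insert (F x) ((\<lambda>a. ?l a x - \<epsilon>) ` S)) else 0)" for x
  have le_F: "F' x \<le> F x" if "x \<in> D" for x using that S(2) by (simp add: F'_def)
  have le_l: "F' x \<le> ?l a x - \<epsilon>" if "x \<in> D" "a \<in> S" for x a
    using that S(2) by (auto simp: F'_def intro!: Min_le)
  have cases_F': "F' x = F x \<or> (\<exists>a\<in>S. F' x = ?l a x - \<epsilon>)" if "x \<in> D" for x
  proof -
    have "F' x \<in> insert (F x) ((\<lambda>a. ?l a x - \<epsilon>) ` S)"
      using that S(2) Min_in[of "insert (F x) ((\<lambda>a. ?l a x - \<epsilon>) ` S)"] by (simp add: F'_def)
    then show ?thesis by blast
  qed
  have sgF: "F.sg x \<subseteq> supergrads D F' x" if "x \<in> D" "F' x = F x" for x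
  proof
    fix a assume a: "a \<in> F.sg x"
    have "F' y \<le> F' x + zvec a \<bullet> (y - x)" if "y \<in> D" for y
    proof -
      have "F y \<le> F x + zvec a \<bullet> (y - x)" using a that unfolding supergrads_def by blast
      then show ?thesis using le_F[OF that] \<open>F' x = F x\<close> by linarith
    qed
    then show "a \<in> supergrads D F' x" unfolding supergrads_def by blast
  qed
  have sgl: "a \<in> supergrads D F' x" if "x \<in> D" "a \<in> S" "F' x = ?l a x - \<epsilon>" for x a
  proof -
    have "F' y \<le> F' x + zvec a \<bullet> (y - x)" if "y \<in> D" for y
      using le_l[OF that \<open>a \<in> S\<close>] \<open>F' x = ?l a x - \<epsilon>\<close> by (simp add: inner_diff_right)
    then show ?thesis unfolding supergrads_def by blast
  qed
  have nn: "0 \<le> F' x" for x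
  proof (cases "x \<in> D")
    case True
    have "0 \<le> ?l a x - \<epsilon>" if "a \<in> S" for a
      using \<epsilon>1[OF that] supp_nonneg[OF D_subset[OF True], of a] by linarith
    then show ?thesis using cases_F'[OF True] F_nonneg[OF D_subset[OF True]] by metis
  qed (simp add: F'_def)
  have "supergrads D F' x \<noteq> {}" if "x \<in> D" for x
    using cases_F'[OF that] sgF[OF that] sgl[OF that] F.supergrads_nonempty[OF that] by blast
  moreover have "F' x = 0" if "x \<in> frontier \<Omega>" for x
    using that by (simp add: F'_def frontier_Omega)
  ultimately have ts: "trop_series \<Omega> F'"
    unfolding trop_series_iff_supergrads[OF interior_nonempty] using nn by blast
  have "P \<subseteq> trop_curve \<Omega> F'"
  proof
    fix p assume p: "p \<in> P"
    then have pD: "p \<in> D" using P_subset by blast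
    have "\<exists>a b. a \<in> supergrads D F' p \<and> b \<in> supergrads D F' p \<and> a \<noteq> b"
    proof (cases "F.sg p \<inter> S = {}")
      \<comment> \<open>No slope of \<open>S\<close> is active at \<open>p\<close>: by the choice of
        \<open>\<epsilon>\<close> the lowered monomials stay at or above \<open>F p\<close>, so the
        old tie remains.\<close>
      case True
      then have "F p \<le> ?l a p - \<epsilon>" if "a \<in> S" for a using \<epsilon>2[OF that p] that by force
      then have "F' p = F p" using cases_F'[OF pD] le_F[OF pD] by force
      moreover obtain a b where "a \<in> F.sg p" "b \<in> F.sg p" "a \<noteq> b"
        using F.two_supergrads[OF pD F_not_differentiable[OF p]] .
      ultimately show ?thesis using sgF[OF pD] by blast
    next
      \<comment> \<open>At least two slopes of \<open>S\<close> are active at \<open>p\<close>, and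
        lowering them by the same amount keeps them tied.\<close>
      case False
      then obtain a where a: "a \<in> F.sg p \<inter> S" by blast
      moreover have "F.sg p \<inter> S \<noteq> {a}" using none p by blast
      ultimately obtain b where b: "b \<in> F.sg p \<inter> S" "a \<noteq> b" by blast
      have "F' p = ?l c p - \<epsilon>" if c: "c \<in> F.sg p \<inter> S" for c
      proof (rule antisym)
        show "F' p \<le> ?l c p - \<epsilon>" using le_l[OF pD] c by blast
        have c_eq: "?l c p = F p" using F.supergrads_iff_coef[OF pD] c by blast
        have "F p - \<epsilon> \<le> ?l d p - \<epsilon>" for d using F.le_coef[OF pD, of d] by simp
        then show "?l c p - \<epsilon> \<le> F' p" unfolding c_eq using cases_F'[OF pD] \<epsilon> by force
      qed
      then show ?thesis using sgl[OF pD] a b by blast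
    qed
    then have "\<not> F' differentiable (at p)"
      using not_differentiable_if_two_supergrads[OF open_interior pD] by blast
    then show "p \<in> trop_curve \<Omega> F'" using pD by (simp add: trop_curve_def)
  qed
  with ts have adm: "admissible F'" by (simp add: admissible_def)
  \<comment> \<open>Where \<open>a\<close> is active, \<open>F'\<close> lies below \<open>F\<close>
    by at least \<open>\<epsilon>\<close>, against minimality of \<open>F\<close>.\<close>
  obtain a where a: "a \<in> S" using S(3) by blast
  then have "F.region a \<noteq> {}" using S(1) unfolding floating_def by blast
  then obtain x where "x \<in> F.region a" by blast
  then have x: "x \<in> D" "a \<in> F.sg x" by (simp_all add: F.region_def)
  then have "?l a x = F x" using F.supergrads_iff_coef by blast
  then have "F' x < F x" using le_l[OF x(1) a] \<epsilon> by linarith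
  then show False using F_le[OF adm D_subset[OF x(1)]] by linarith
qed

text \<open>Peeling handles finite sets; its bound is uniform over the finite subsets, which also
  yields finiteness of \<open>floating\<close>.\<close>

lemma floating_bound: "finite floating \<and> card floating \<le> card P"
proof (rule finite_if_finite_subsets_card_bdd)
  fix T assume T: "T \<subseteq> floating" "finite T"
  have "card T \<le> card {p \<in> P. F.sg p \<inter> T \<noteq> {}}"
  proof (rule card_le_by_peeling[OF finite_P T(2)])
    fix S assume "S \<subseteq> T" "S \<noteq> {}"
    then show "\<exists>p\<in>P. \<exists>s. F.sg p \<inter> S = {s}"
      using T by (intro floating_peel) (auto intro: finite_subset)
  qed
  also have "\<dots> \<le> card P" using finite_P by (intro card_mono) auto
  finally show "card T \<le> card P" .
qed

section \<open>Regions at the frontier and the genus\<close>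

text \<open>On the region \<open>F\<close> is at least the excess \<open>\<eta>\<close> of the
  coefficient over \<open>supp a\<close>, whereas the barrier makes \<open>F\<close> small near any
  frontier point.\<close>

lemma closure_region_if_floating:
  assumes "supp a < coef D F a"
  shows "closure (F.region a) \<inter> frontier \<Omega> = {}"
proof (rule ccontr)
  assume "\<not> ?thesis"
  then obtain z where z: "z \<in> closure (F.region a)" "z \<in> frontier \<Omega>" by blast
  define \<eta> where "\<eta> = coef D F a - supp a"
  have \<eta>: "\<eta> > 0" using assms by (simp add: \<eta>_def)
  define \<delta> where "\<delta> = \<eta> / (real (card P) + 1)"
  have \<delta>: "\<delta> > 0" using \<eta> by (simp add: \<delta>_def)
  obtain b where b: "b \<noteq> 0" "supp b + zvec b \<bullet> z < \<delta>" using supp_small_at_frontier[OF z(2) \<delta>] by blast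
  have "F.region a \<subseteq> {x. \<eta> \<le> real (card P) * (supp b + zvec b \<bullet> x)}"
  proof
    fix x assume x: "x \<in> F.region a"
    then have xD: "x \<in> D" "a \<in> F.sg x" by (auto simp: F.region_def)
    have "\<eta> \<le> coef D F a + zvec a \<bullet> x"
      using supp_nonneg[OF D_subset[OF xD(1)], of a] by (simp add: \<eta>_def)
    also have "\<dots> = F x" using F.supergrads_iff_coef[OF xD(1)] xD(2) by blast
    also have "\<dots> \<le> barrier P x" using F_le[OF admissible_barrier D_subset[OF xD(1)]] .
    also have "\<dots> \<le> real (card P) * (supp b + zvec b \<bullet> x)" using barrier_le[OF xD(1) b(1)] .
    finally show "x \<in> {x. \<eta> \<le> real (card P) * (supp b + zvec b \<bullet> x)}" by simp
  qed
  moreover have "closed {x. \<eta> \<le> real (card P) * (supp b + zvec b \<bullet> x)}"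
    by (intro closed_Collect_le continuous_intros)
  ultimately have "closure (F.region a) \<subseteq> {x. \<eta> \<le> real (card P) * (supp b + zvec b \<bullet> x)}"
    by (rule closure_minimal)
  then have "\<eta> \<le> real (card P) * (supp b + zvec b \<bullet> z)" using z(1) by blast
  also have "\<dots> \<le> real (card P) * \<delta>" using b(2) by (intro mult_left_mono) auto
  also have "\<dots> < (real (card P) + 1) * \<delta>" using \<delta> by simp
  also have "\<dots> = \<eta>" by (simp add: \<delta>_def)
  finally show False by simp
qed

text \<open>The monomial of slope \<open>a\<close> vanishes at a frontier point \<open>z\<close>,
  where all others are nonnegative. On the open segment from a point of the region to
  \<open>z\<close> it therefore stays the unique minimum.\<close>

lemma closure_region_if_not_floating:
  assumes "F.region a \<noteq> {}" "coef D F a = supp a"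
  shows "closure (F.region a) \<inter> frontier \<Omega> \<noteq> {}"
proof -
  let ?l = "\<lambda>a x. coef D F a + zvec a \<bullet> x"
  obtain z where z: "z \<in> frontier \<Omega>" "?l a z = 0" using supp_attained[of a] assms(2) by auto
  obtain x where x: "x \<in> F.region a" using assms(1) by blast
  then have xD: "x \<in> D" and sgx: "F.sg x = {a}" by (auto simp: F.region_def)
  have z\<Omega>: "z \<in> \<Omega>" "z \<noteq> x" using z(1) xD by (auto simp: frontier_Omega)
  have lz: "0 \<le> ?l b z" for b
  proof (rule affine_nonneg_on_Omega[OF _ z\<Omega>(1)])
    show "0 \<le> ?l b y" if "y \<in> D" for y
      using F.le_coef[OF that, of b] F_nonneg[OF D_subset[OF that]] by linarith
  qed
  have "open_segment x z \<subseteq> F.region a"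
  proof
    fix y assume y: "y \<in> open_segment x z"
    have yD: "y \<in> D"
      using in_interior_closure_convex_segment[OF convex_Omega xD] z\<Omega>(1) closure_subset y by blast
    obtain t where t: "0 < t" "t < 1" "y = (1 - t) *\<^sub>R x + t *\<^sub>R z"
      using y by (auto simp: in_segment)
    have aff: "?l b y = (1 - t) * ?l b x + t * ?l b z" for b
      by (simp add: t(3) inner_add_right algebra_simps)
    have "b = a" if b: "b \<in> F.sg y" for b
    proof -
      have "?l b y \<le> ?l a y" using F.supergrads_iff_coef[OF yD, of b] b F.le_coef[OF yD, of a] by simp
      moreover have "0 \<le> t * ?l b z" using lz[of b] t(1) by simp
      ultimately have "(1 - t) * ?l b x \<le> (1 - t) * ?l a x" unfolding aff using z(2) by simp
      then have "?l b x \<le> ?l a x" using t(2) by simp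
      moreover have "?l a x = F x" using F.supergrads_iff_coef[OF xD, of a] sgx by simp
      ultimately have "b \<in> F.sg x"
        using F.supergrads_iff_coef[OF xD, of b] F.le_coef[OF xD, of b] by simp
      then show ?thesis using sgx by simp
    qed
    then have "F.sg y = {a}" using F.supergrads_nonempty[OF yD] by blast
    then show "y \<in> F.region a" using yD by (simp add: F.region_def)
  qed
  then have "closure (open_segment x z) \<subseteq> closure (F.region a)" by (rule closure_mono)
  moreover have "z \<in> closure (open_segment x z)" using z\<Omega>(2) by (simp add: closure_open_segment)
  ultimately show ?thesis using z(1) by blast
qed

lemma genus_eq_card_floating: "trop_genus \<Omega> F = card floating"
proof -
  have "interior \<Omega> - trop_curve \<Omega> F = D - {x \<in> D. \<not> F differentiable (at x)}"
    by (simp add: trop_curve_def)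
  then have comp: "components (interior \<Omega> - trop_curve \<Omega> F) = F.region ` {a. F.region a \<noteq> {}}"
    using F.components_regions convex_interior[OF convex_Omega] by simp
  have iff: "closure (F.region a) \<inter> frontier \<Omega> = {} \<longleftrightarrow> a \<in> floating" if "F.region a \<noteq> {}" for a
    using that closure_region_if_floating[of a] closure_region_if_not_floating[OF that]
      supp_le_coef[OF F.trop_on_axioms, of a] unfolding floating_def by force
  have "{U \<in> components (interior \<Omega> - trop_curve \<Omega> F). closure U \<inter> frontier \<Omega> = {}} = F.region ` floating"
  proof (intro set_eqI iffI)
    fix U assume "U \<in> {U \<in> components (interior \<Omega> - trop_curve \<Omega> F). closure U \<inter> frontier \<Omega> = {}}"
    then obtain a where "F.region a \<noteq> {}" "U = F.region a" "closure U \<inter> frontier \<Omega> = {}"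
      unfolding comp by blast
    then show "U \<in> F.region ` floating" using iff by blast
  next
    fix U assume "U \<in> F.region ` floating"
    then obtain a where a: "a \<in> floating" "U = F.region a" by blast
    then have "F.region a \<noteq> {}" by (simp add: floating_def)
    then show "U \<in> {U \<in> components (interior \<Omega> - trop_curve \<Omega> F). closure U \<inter> frontier \<Omega> = {}}"
      unfolding comp using a iff by blast
  qed
  moreover have "inj_on F.region floating"
    using F.inj_on_region by (rule inj_on_subset) (auto simp: floating_def)
  ultimately show ?thesis by (simp add: trop_genus_def card_image)
qed

section \<open>Generic position and the lower bound\<close>

text \<open>Slopes with nonempty regions are chosen so that each coefficient in the tie is either a
  floating unknown or the constant \<open>supp\<close>.\<close>

lemma coef_at_P:
  assumes "p \<in> P"
  obtains a b where "a \<noteq> b" "(zvec b - zvec a) \<bullet> p = coef D F a - coef D F b"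
    "a \<in> floating \<or> coef D F a = supp a" "b \<in> floating \<or> coef D F b = supp b"
proof -
  have pD: "p \<in> D" using assms P_subset by blast
  obtain a b where ab: "a \<in> F.sg p" "b \<in> F.sg p" "a \<noteq> b" "F.region a \<noteq> {}" "F.region b \<noteq> {}"
    using F.two_adjacent_regions[OF pD F_not_differentiable[OF assms]] .
  have "coef D F a + zvec a \<bullet> p = F p" "coef D F b + zvec b \<bullet> p = F p"
    using F.supergrads_iff_coef[OF pD] ab(1,2) by blast+
  then have "(zvec b - zvec a) \<bullet> p = coef D F a - coef D F b" by (simp add: inner_diff_left)
  moreover have "c \<in> floating \<or> coef D F c = supp c" if "F.region c \<noteq> {}" for c
    using that supp_le_coef[OF F.trop_on_axioms, of c] by (auto simp: floating_def)
  ultimately show ?thesis using ab that by blast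
qed

end

context trop_domain
begin

text \<open>Consider the ties \<open>c (A ! k) + zvec (A ! k) \<bullet> p k = c (B ! k) + zvec (B ! k) \<bullet> p k\<close> for
  coefficients \<open>c\<close> that are unknown on \<open>S\<close> and equal to \<open>supp\<close> elsewhere. Fewer than \<open>n\<close> unknowns
  can be eliminated from \<open>n\<close> equations, which leaves an affine relation between the \<open>p k\<close>; the lemma
  says that generic points violate all these relations.\<close>
lemma AE_no_relation:
  "AE p in PiM {..<n} (\<lambda>_. lborel). \<forall>A B S :: (int \<times> int) list.
     (\<forall>k<n. A ! k \<noteq> B ! k) \<longrightarrow> card (set S) < n \<longrightarrow>
     (\<exists>w :: nat \<Rightarrow> real. (\<forall>s\<in>set S. (\<Sum>k<n. w k * (of_bool (s = A ! k) - of_bool (s = B ! k))) = 0) \<and>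
        (\<Sum>k<n. (w k *\<^sub>R (zvec (B ! k) - zvec (A ! k))) \<bullet> p k) \<noteq>
        (\<Sum>k<n. w k * ((if A ! k \<in> set S then 0 else supp (A ! k)) - (if B ! k \<in> set S then 0 else supp (B ! k)))))"
  \<comment> \<open>Lists form a countable type, so it suffices to treat one triple at a
    time.\<close>
  unfolding AE_all_countable
proof (intro allI)
  fix A B S :: "(int \<times> int) list"
  let ?Q = "\<lambda>w p. (\<forall>s\<in>set S. (\<Sum>k<n. w k * (of_bool (s = A ! k) - of_bool (s = B ! k))) = 0) \<and>
        (\<Sum>k<n. (w k *\<^sub>R (zvec (B ! k) - zvec (A ! k))) \<bullet> p k) \<noteq>
        (\<Sum>k<n. w k * ((if A ! k \<in> set S then 0 else supp (A ! k)) - (if B ! k \<in> set S then 0 else supp (B ! k))))"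
  show "AE p in PiM {..<n} (\<lambda>_. lborel). (\<forall>k<n. A ! k \<noteq> B ! k) \<longrightarrow> card (set S) < n \<longrightarrow> (\<exists>w. ?Q w p)"
  proof (cases "(\<forall>k<n. A ! k \<noteq> B ! k) \<and> card (set S) < n")
    case True
    have "\<exists>w. (\<exists>k\<in>{..<n}. w k \<noteq> 0) \<and>
      (\<forall>s\<in>set S. (\<Sum>k<n. w k * (of_bool (s = A ! k) - of_bool (s = B ! k))) = (0::real))"
      using True by (intro underdetermined_system_solution) auto
    then obtain w :: "nat \<Rightarrow> real" and i where w: "i < n" "w i \<noteq> 0"
      "\<forall>s\<in>set S. (\<Sum>k<n. w k * (of_bool (s = A ! k) - of_bool (s = B ! k))) = 0"
      by blast
    \<comment> \<open>Distinct slopes give \<open>p i\<close> a nonzero coefficient, so the relation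
      left after elimination is a genuine hyperplane.\<close>
    have "A ! i \<noteq> B ! i" using True w(1) by blast
    then have ne: "w i *\<^sub>R (zvec (B ! i) - zvec (A ! i)) \<noteq> 0" using w(2) by simp
    have i: "i \<in> {..<n}" using w(1) by simp
    show ?thesis
      using AE_PiM_lborel_not_hyperplane[of "{..<n}" i "\<lambda>k. w k *\<^sub>R (zvec (B ! k) - zvec (A ! k))"
          "\<Sum>k<n. w k * ((if A ! k \<in> set S then 0 else supp (A ! k)) - (if B ! k \<in> set S then 0 else supp (B ! k)))",
          OF finite_lessThan i ne]
    proof (rule AE_mp, intro AE_I2 impI)
      fix p :: "nat \<Rightarrow> real \<times> real"
      assume "(\<Sum>k<n. (w k *\<^sub>R (zvec (B ! k) - zvec (A ! k))) \<bullet> p k) \<noteq>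
        (\<Sum>k<n. w k * ((if A ! k \<in> set S then 0 else supp (A ! k)) - (if B ! k \<in> set S then 0 else supp (B ! k))))"
      with w(3) show "\<exists>w. ?Q w p" by (intro exI[of _ w] conjI)
    qed
  next
    case False
    then show ?thesis by (intro AE_I2) blast
  qed
qed

end

theorem mainTheorem1:
  fixes \<Omega> :: "(real \<times> real) set" and n :: nat
  assumes "compact \<Omega>" and "convex \<Omega>" and "interior \<Omega> \<noteq> {}" and "n \<ge> 1"
  shows "AE p in PiM {..<n} (\<lambda>_. lborel).
           p \<in> PiE {..<n} (\<lambda>_. interior \<Omega>) \<longrightarrow>
           trop_genus \<Omega> (G_op \<Omega> (p ` {..<n}) zero_Omega) = n"
proof -
  interpret trop_domain \<Omega> using assms by unfold_locales
  show ?thesis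
    using AE_no_relation[of n]
  proof (rule AE_mp, intro AE_I2 impI)
    fix p
    assume gen: "\<forall>A B S :: (int \<times> int) list.
     (\<forall>k<n. A ! k \<noteq> B ! k) \<longrightarrow> card (set S) < n \<longrightarrow>
     (\<exists>w :: nat \<Rightarrow> real. (\<forall>s\<in>set S. (\<Sum>k<n. w k * (of_bool (s = A ! k) - of_bool (s = B ! k))) = 0) \<and>
        (\<Sum>k<n. (w k *\<^sub>R (zvec (B ! k) - zvec (A ! k))) \<bullet> p k) \<noteq>
        (\<Sum>k<n. w k * ((if A ! k \<in> set S then 0 else supp (A ! k)) - (if B ! k \<in> set S then 0 else supp (B ! k)))))"
      and p: "p \<in> PiE {..<n} (\<lambda>_. interior \<Omega>)"
    have "p ` {..<n} \<subseteq> D" using p by (simp add: PiE_iff image_subset_iff)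
    then interpret trop_problem \<Omega> "p ` {..<n}" by unfold_locales simp_all
    let ?c = "coef D F"
    have fin: "finite floating" and "card floating \<le> card (p ` {..<n})" using floating_bound by auto
    then have upper: "card floating \<le> n" using card_image_le[of "{..<n}" p] by simp
    have "\<not> card floating < n"
    proof
      assume less: "card floating < n"
      obtain S where S: "set S = floating" using finite_list[OF fin] by blast
      have "\<forall>k. \<exists>ab. k < n \<longrightarrow> fst ab \<noteq> snd ab \<and> (zvec (snd ab) - zvec (fst ab)) \<bullet> p k = ?c (fst ab) - ?c (snd ab) \<and>
        (fst ab \<in> floating \<or> ?c (fst ab) = supp (fst ab)) \<and> (snd ab \<in> floating \<or> ?c (snd ab) = supp (snd ab))"
      proof
        fix k
        show "\<exists>ab. k < n \<longrightarrow> fst ab \<noteq> snd ab \<and> (zvec (snd ab) - zvec (fst ab)) \<bullet> p k = ?c (fst ab) - ?c (snd ab) \<and>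
          (fst ab \<in> floating \<or> ?c (fst ab) = supp (fst ab)) \<and> (snd ab \<in> floating \<or> ?c (snd ab) = supp (snd ab))"
        proof (cases "k < n")
          case True
          then have "p k \<in> p ` {..<n}" by simp
          then obtain a b where "a \<noteq> b" "(zvec b - zvec a) \<bullet> p k = ?c a - ?c b"
            "a \<in> floating \<or> ?c a = supp a" "b \<in> floating \<or> ?c b = supp b"
            using coef_at_P by blast
          then show ?thesis by (intro exI[of _ "(a, b)"]) simp
        qed simp
      qed
      from choice[OF this] obtain ab where ab: "\<And>k. k < n \<Longrightarrow> fst (ab k) \<noteq> snd (ab k) \<and>
        (zvec (snd (ab k)) - zvec (fst (ab k))) \<bullet> p k = ?c (fst (ab k)) - ?c (snd (ab k)) \<and>
        (fst (ab k) \<in> floating \<or> ?c (fst (ab k)) = supp (fst (ab k))) \<and>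
        (snd (ab k) \<in> floating \<or> ?c (snd (ab k)) = supp (snd (ab k)))" by blast
      define A where "A = map (\<lambda>k. fst (ab k)) [0..<n]"
      define B where "B = map (\<lambda>k. snd (ab k)) [0..<n]"
      have AB: "A ! k \<noteq> B ! k" "(zvec (B ! k) - zvec (A ! k)) \<bullet> p k = ?c (A ! k) - ?c (B ! k)"
        "A ! k \<in> floating \<or> ?c (A ! k) = supp (A ! k)" "B ! k \<in> floating \<or> ?c (B ! k) = supp (B ! k)"
        if "k < n" for k
        using ab[OF that] that by (simp_all add: A_def B_def)
      define m where "m a = (if a \<in> set S then 0 else supp a)" for a
      obtain w :: "nat \<Rightarrow> real" where
        w: "\<forall>s\<in>set S. (\<Sum>k<n. w k * (of_bool (s = A ! k) - of_bool (s = B ! k))) = 0" and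
        ne: "(\<Sum>k<n. (w k *\<^sub>R (zvec (B ! k) - zvec (A ! k))) \<bullet> p k) \<noteq> (\<Sum>k<n. w k * (m (A ! k) - m (B ! k)))"
        using gen[rule_format, of A B S] AB(1) less S unfolding m_def by auto
      \<comment> \<open>The contribution of the unknowns to \<open>?c a\<close>; \<open>m\<close>
        holds the constants.\<close>
      define q where "q a = (\<Sum>s\<in>set S. ?c s * of_bool (s = a))" for a
      have c_eq: "?c a = m a + q a" if "a \<in> floating \<or> ?c a = supp a" for a
      proof -
        have "q a = (\<Sum>s\<in>set S. if s = a then ?c s else 0)"
          unfolding q_def by (rule sum.cong) auto
        then show ?thesis using that by (auto simp: m_def S[symmetric])
      qed
      have "(\<Sum>k<n. (w k *\<^sub>R (zvec (B ! k) - zvec (A ! k))) \<bullet> p k) = (\<Sum>k<n. w k * (?c (A ! k) - ?c (B ! k)))"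
        using AB(2) by (intro sum.cong) auto
      also have "\<dots> = (\<Sum>k<n. w k * (m (A ! k) - m (B ! k)) +
          (\<Sum>s\<in>set S. ?c s * (w k * (of_bool (s = A ! k) - of_bool (s = B ! k)))))"
      proof (rule sum.cong[OF refl])
        fix k assume "k \<in> {..<n}"
        then have k: "k < n" by simp
        have "(\<Sum>s\<in>set S. ?c s * (w k * (of_bool (s = A ! k) - of_bool (s = B ! k)))) =
          w k * (q (A ! k) - q (B ! k))"
          unfolding q_def sum_subtractf[symmetric] sum_distrib_left
          by (rule sum.cong) (auto simp: algebra_simps)
        then show "w k * (?c (A ! k) - ?c (B ! k)) = w k * (m (A ! k) - m (B ! k)) +
          (\<Sum>s\<in>set S. ?c s * (w k * (of_bool (s = A ! k) - of_bool (s = B ! k))))"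
          using c_eq[OF AB(3)[OF k]] c_eq[OF AB(4)[OF k]] by (simp add: algebra_simps)
      qed
      \<comment> \<open>After exchanging the sums, each unknown is multiplied by an expression that
        \<open>w\<close> makes zero; what is left is the relation excluded for generic
        \<open>p\<close>.\<close>
      also have "\<dots> = (\<Sum>k<n. w k * (m (A ! k) - m (B ! k))) +
          (\<Sum>s\<in>set S. ?c s * (\<Sum>k<n. w k * (of_bool (s = A ! k) - of_bool (s = B ! k))))"
        unfolding sum.distrib sum_distrib_left by (subst sum.swap) simp
      also have "\<dots> = (\<Sum>k<n. w k * (m (A ! k) - m (B ! k)))" using w by simp
      finally show False using ne by simp
    qed
    with upper have "card floating = n" by simp
    then show "trop_genus \<Omega> (G_op \<Omega> (p ` {..<n}) zero_Omega) = n"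
      using genus_eq_card_floating by simp
  qed
qed

end
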